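(* Let $\alpha>0$ and $\beta>0$. Then the Gaussian Bessel potential $\mathcal{J}_\beta$ is bounded from the Gaussian Lipschitz space $Lip_{\alpha}(\gamma)$ to $Lip_{\alpha+\beta}(\gamma)$; that is, $\mathcal{J}_\beta f\in Lip_{\alpha+\beta}(\gamma)$ for every $f\in Lip_\alpha(\gamma)$ and there is a constant $C$, independent of $f$, such that $\|\mathcal{J}_\beta f\|_{Lip_{\alpha+\beta}(\gamma)}\le C\|f\|_{Lip_\alpha(\gamma)}$ for all $f\in Lip_\alpha(\gamma)$.
   Context: Fix $d\ge 1$ and let $d\gamma(x)=\pi^{-d/2}e^{-|x|^2}dx$ be the Gaussian measure on $\mathbb{R}^d$; $\|\cdot\|_\infty$ is the norm of $L^\infty=L^\infty(\gamma)$. The Ornstein-Uhlenbeck semigroup is $T_0f=f$ and, for $t>0$, $$T_tf(x)=\frac{1}{\pi^{d/2}(1-e^{-2t})^{d/2}}\int_{\mathbb{R}^d}\exp\left(-\frac{|y-e^{-t}x|^2}{1-e^{-2t}}\right)f(y)\,dy ,$$ with generator $L=\frac12\Delta-\langle x,\nabla\rangle$. The Poisson-Hermite semigroup (generator $-(-L)^{1/2}$) is $$P_tf(x)=\frac{1}{\sqrt{\pi}}\int_0^\infty\frac{e^{-u}}{\sqrt{u}}\,T_{t^2/4u}f(x)\,du,\quad t>0,\qquad P_0f=f.$$ Gaussian Lipschitz spaces: for $\alpha>0$ let $n$ be the smallest integer greater than $\alpha$. $Lip_\alpha(\gamma)$ is the set of $f\in L^\infty$ for which there is a constant $A$ such that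 $\left\|\frac{\partial^nP_tf}{\partial t^n}\right\|_\infty\le A\,t^{-n+\alpha}$ for all $t>0$. The smallest such $A$ is denoted $A_\alpha(f)$, and $\|f\|_{Lip_\alpha(\gamma)}=\|f\|_\infty+A_\alpha(f)$. The Bessel potential of order $\beta>0$, formally $\mathcal{J}_\beta=(I+\sqrt{-L})^{-\beta}$, is given by $$\mathcal{J}_\beta f(x)=\frac{1}{\Gamma(\beta)}\int_0^{\infty}s^{\beta-1}e^{-s}P_sf(x)\,ds .$$ *)

theory Defs
  imports "HOL-Probability.Essential_Supremum"
begin

definition gauss :: "'a::euclidean_space measure" where
  "gauss = density lborel
     (\<lambda>x. ennreal (pi powr (- (real DIM('a) / 2)) * exp (- (norm x)\<^sup>2)))"

text \<open>
  Elements of \<open>L\<^sup>\<infinity>(\<gamma>)\<close> are represented by Borel functions. The norm is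
  extended-real valued; \<open>esssup\<close> is \<open>\<infinity>\<close> when \<open>\<bar>f\<bar>\<close> is not measurable or not
  essentially bounded.
\<close>

definition Linf_norm :: "('a::euclidean_space \<Rightarrow> real) \<Rightarrow> ereal" where
  "Linf_norm f = esssup gauss (\<lambda>x. ereal \<bar>f x\<bar>)"

definition Linf :: "('a::euclidean_space \<Rightarrow> real) set" where
  "Linf = {f \<in> borel_measurable gauss. Linf_norm f < \<infinity>}"

text \<open>
  For \<open>f \<in> Linf\<close> all the integrals below converge absolutely at every point \<open>x\<close>.
  Negative times play no role; the operators are set to the identity there.
\<close>

definition ornstein_uhlenbeck ::
    "real \<Rightarrow> ('a::euclidean_space \<Rightarrow> real) \<Rightarrow> 'a \<Rightarrow> real" where
  "ornstein_uhlenbeck t f x =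
     (if t > 0 then
        1 / (pi powr (real DIM('a) / 2) * (1 - exp (- 2 * t)) powr (real DIM('a) / 2)) *
        (LBINT y. exp (- ((norm (y - exp (- t) *\<^sub>R x))\<^sup>2 / (1 - exp (- 2 * t)))) * f y)
      else f x)"

definition poisson_hermite ::
    "real \<Rightarrow> ('a::euclidean_space \<Rightarrow> real) \<Rightarrow> 'a \<Rightarrow> real" where
  "poisson_hermite t f x =
     (if t > 0 then
        1 / sqrt pi *
        (LBINT u:{0<..}. exp (- u) / sqrt u * ornstein_uhlenbeck (t\<^sup>2 / (4 * u)) f x)
      else f x)"

definition bessel_potential ::
    "real \<Rightarrow> ('a::euclidean_space \<Rightarrow> real) \<Rightarrow> 'a \<Rightarrow> real" where
  "bessel_potential \<beta> f x =
     1 / Gamma \<beta> * (LBINT s:{0<..}. s powr (\<beta> - 1) * exp (- s) * poisson_hermite s f x)"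

definition lip_order :: "real \<Rightarrow> nat" where
  "lip_order \<alpha> = (LEAST n. \<alpha> < real n)"

text \<open>
  The time derivative is taken pointwise in \<open>x\<close>. For \<open>f \<in> Linf\<close> the function
  \<open>t \<mapsto> poisson_hermite t f x\<close> is smooth on \<open>t > 0\<close>, so \<open>deriv\<close> never
  returns an unspecified value in the condition below.
\<close>

definition lip_bound ::
    "real \<Rightarrow> ('a::euclidean_space \<Rightarrow> real) \<Rightarrow> real \<Rightarrow> bool" where
  "lip_bound \<alpha> f A \<longleftrightarrow>
     (\<forall>t>0. Linf_norm (\<lambda>x. (deriv ^^ lip_order \<alpha>) (\<lambda>s. poisson_hermite s f x) t)
             \<le> ereal (A * t powr (- real (lip_order \<alpha>) + \<alpha>)))"

definition gauss_Lip :: "real \<Rightarrow> ('a::euclidean_space \<Rightarrow> real) set" where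
  "gauss_Lip \<alpha> = {f \<in> Linf. \<exists>A. lip_bound \<alpha> f A}"

definition lip_const :: "real \<Rightarrow> ('a::euclidean_space \<Rightarrow> real) \<Rightarrow> real" where
  "lip_const \<alpha> f = (LEAST A. lip_bound \<alpha> f A)"

definition gauss_Lip_norm :: "real \<Rightarrow> ('a::euclidean_space \<Rightarrow> real) \<Rightarrow> ereal" where
  "gauss_Lip_norm \<alpha> f = Linf_norm f + ereal (lip_const \<alpha> f)"

end

theory Submission
  imports Defs "HOL-Probability.Probability" "HOL-Computational_Algebra.Polynomial"
begin

text \<open>
The starting point is to move the time dependence of \<open>P\<^sub>t\<close> into a kernel. The substitution
\<open>r = t\<^sup>2 / 4u\<close> turns the defining formula into \<open>P\<^sub>t f = \<integral> \<mu>\<^sub>t(r) T\<^sub>r f dr\<close>, where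
\<open>\<mu>\<^sub>t(r) = t / (2 \<surd>\<pi>) r\<^bsup>-3/2\<^esup> exp (- t\<^sup>2 / 4r)\<close> is the density of the one-sided stable law of
index 1/2. Its \<open>k\<close>-th time derivative is \<open>levy k t\<close>. It is dominated by \<open>t\<^bsup>-k\<^esup>\<close> times a
density of the same family (\<open>levy_bound\<close>), so one may differentiate under the integral, and
\<open>poisson_deriv k t f = \<integral> levy k t r T\<^sub>r f dr\<close> is the \<open>k\<close>-th time derivative of \<open>P\<^sub>t f\<close> at every
point, with \<open>\<bar>poisson_deriv k t f\<bar> \<le> C\<^sub>k t\<^bsup>-k\<^esup> \<parallel>f\<parallel>\<^sub>\<infinity>\<close>.

The densities \<open>\<mu>\<^sub>t\<close> form a convolution semigroup (\<open>levy_0_convolution\<close>), and so do the Mehler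
kernels of \<open>T\<^sub>r\<close> (\<open>mehler_chapman_kolmogorov\<close>). Differentiating the first in both time parameters
gives \<open>D\<^sub>j\<^sub>,\<^sub>s D\<^sub>k\<^sub>,\<^sub>a f = D\<^sub>j\<^sub>+\<^sub>k\<^sub>,\<^sub>s\<^sub>+\<^sub>a f\<close> for the operators \<open>D\<^sub>k\<^sub>,\<^sub>t = poisson_deriv k t\<close>
(\<open>poisson_deriv_semigroup\<close>).

Let \<open>m\<close> and \<open>n\<close> be the orders of differentiation belonging to \<open>\<alpha>\<close> and \<open>\<alpha> + \<beta>\<close>; then \<open>m \<le> n\<close>.
Writing \<open>D\<^sub>n\<^sub>,\<^sub>t = D\<^sub>n\<^sub>-\<^sub>m\<^sub>,\<^sub>t\<^sub>/\<^sub>2 D\<^sub>m\<^sub>,\<^sub>t\<^sub>/\<^sub>2\<close> transfers the Lipschitz condition from order \<open>m\<close> to order \<open>n\<close>: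
\<open>\<bar>D\<^sub>n\<^sub>,\<^sub>t f(x)\<bar> \<le> C A t\<^bsup>-n+\<alpha>\<^esup>\<close>. The outer factor is an integral operator with an
absolutely continuous kernel, so this bound holds at every \<open>x\<close>, although the hypothesis holds only
almost everywhere. Hence no exceptional null sets accumulate when it is used for all times at once
in the identity
\<open>D\<^sub>n\<^sub>,\<^sub>t (J\<^sub>\<beta> f) = 1 / \<Gamma>(\<beta>) \<integral> s\<^bsup>\<beta>-1\<^esup> e\<^bsup>-s\<^esup> D\<^sub>n\<^sub>,\<^sub>t\<^sub>+\<^sub>s f ds\<close> (\<open>poisson_deriv_bessel_potential\<close>),
and \<open>\<integral> s\<^bsup>\<beta>-1\<^esup> (t + s)\<^bsup>-n+\<alpha>\<^esup> ds \<le> C t\<^bsup>-n+\<alpha>+\<beta>\<^esup>\<close> because \<open>n > \<alpha> + \<beta>\<close>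
(\<open>gamma_weight_power_integral\<close>). The supremum norm does not increase under \<open>J\<^sub>\<beta>\<close>, since \<open>J\<^sub>\<beta>\<close>
is an average of the contractions \<open>P\<^sub>s\<close> with respect to a probability density.
\<close>

section \<open>Derivatives of the one-sided stable density\<close>

text \<open>
An error function with unspecified normalisation, obtained as \<open>\<surd>\<pi>\<close> times the distribution
function of a normal law. It supplies the primitive in \<open>levy_0_convolution\<close>, where only its total
increase \<open>\<surd>\<pi>\<close> matters.
\<close>
lemma gaussian_antiderivative:
  "\<exists>\<Psi>::real \<Rightarrow> real. \<exists>l u. (\<forall>w. (\<Psi> has_real_derivative exp (- w\<^sup>2)) (at w)) \<and>
     (\<Psi> \<longlongrightarrow> l) at_bot \<and> (\<Psi> \<longlongrightarrow> u) at_top \<and> u - l = sqrt pi"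
proof -
  interpret real_distribution std_normal_distribution by (rule real_dist_normal_dist)
  obtain F :: "real \<Rightarrow> real" where F: "\<And>x. (F has_real_derivative std_normal_density x) (at x)"
  proof -
    have "isCont std_normal_density x" for x
      unfolding std_normal_density_def by (intro continuous_intros) auto
    with einterval_antiderivative[of "-\<infinity>" "\<infinity>" std_normal_density] show ?thesis
      using that by (auto simp: has_real_derivative_iff_has_vector_derivative)
  qed
  let ?G = "cdf std_normal_distribution"
  have inc: "?G y - ?G x = F y - F x" if "x < y" for x y
  proof -
    have "?G y - ?G x = measure std_normal_distribution {x<..y}"
      using cdf_diff_eq that by auto
    also have "\<dots> = (\<integral>z. indicator {x<..y} z * std_normal_density z \<partial>lborel)"
      using integral_density[of "indicator {x<..y} :: real \<Rightarrow> real" lborel std_normal_density]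
      by (simp add: mult.commute)
    also have "\<dots> = (\<integral>z. indicator {x..y} z *\<^sub>R std_normal_density z \<partial>lborel)"
      by (rule integral_cong_AE) (use AE_lborel_singleton[of x] in \<open>auto simp: indicator_def\<close>)
    also have "\<dots> = F y - F x"
      by (rule integral_FTC_Icc)
       (use that F in \<open>auto simp: std_normal_density_def has_real_derivative_iff_has_vector_derivative 
        intro!: continuous_intros intro: has_vector_derivative_at_within\<close>)
    finally show ?thesis .
  qed
  define c where "c = ?G 0 - F 0"
  have "?G x = F x + c" for x
    using inc[of 0 x] inc[of x 0] by (cases "x = 0"; cases "x < 0") (auto simp: c_def)
  then have Geq: "?G = (\<lambda>x. F x + c)" by auto
  have G: "(?G has_real_derivative std_normal_density x) (at x)" for x
    unfolding Geq by (auto intro!: derivative_eq_intros F)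
  let ?\<Psi> = "\<lambda>w. sqrt pi * ?G (sqrt 2 * w)"
  have 1: "(?\<Psi> has_real_derivative exp (- w\<^sup>2)) (at w)" for w
    by (rule derivative_eq_intros DERIV_chain2[OF G] refl)+
       (simp add: std_normal_density_def power_mult_distrib real_sqrt_mult)
  have "filterlim (\<lambda>w. sqrt 2 * w :: real) at_bot at_bot"
    by (rule filterlim_tendsto_pos_mult_at_bot[OF tendsto_const]) (auto simp: filterlim_ident)
  from filterlim_compose[OF cdf_lim_at_bot this]
  have 2: "(?\<Psi> \<longlongrightarrow> sqrt pi * 0) at_bot" by (intro tendsto_intros)
  have "filterlim (\<lambda>w. sqrt 2 * w :: real) at_top at_top"
    by (rule filterlim_tendsto_pos_mult_at_top[OF tendsto_const]) (auto simp: filterlim_ident)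
  from filterlim_compose[OF cdf_lim_at_top_prob this]
  have 3: "(?\<Psi> \<longlongrightarrow> sqrt pi * 1) at_top" by (intro tendsto_intros)
  show ?thesis using 1 2 3 by (intro exI[of _ ?\<Psi>] exI conjI) auto
qed

text \<open>
With \<open>u = t\<^sup>2 / 4r\<close> one has \<open>\<partial>\<^sub>t \<mu>\<^sub>t = t\<^bsup>-1\<^esup> (1 - 2u) \<mu>\<^sub>t\<close> and \<open>\<partial>\<^sub>t u = 2u / t\<close>, so the
\<open>k\<close>-th derivative of \<open>\<mu>\<^sub>t\<close> is \<open>t\<^bsup>-k\<^esup> Q\<^sub>k(u) \<mu>\<^sub>t\<close> for polynomials \<open>Q\<^sub>k\<close> obeying the
recursion \<open>Q\<^sub>k\<^sub>+\<^sub>1 = (1 - k - 2u) Q\<^sub>k + 2u Q\<^sub>k'\<close>.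
\<close>
fun levy_poly :: "nat \<Rightarrow> real poly" where
  "levy_poly 0 = 1"
| "levy_poly (Suc k) = [:1 - real k, -2:] * levy_poly k + [:0, 2:] * pderiv (levy_poly k)"

text \<open>
\<open>levy 0 t\<close> is the density of the hitting time of a level by Brownian motion (the Levy law), the
subordinator that produces \<open>exp (- t \<surd>(- L))\<close> from \<open>exp (r L)\<close>. The value 0 for \<open>r \<le> 0\<close> allows all
integrals to be taken over the whole line.
\<close>
definition levy :: "nat \<Rightarrow> real \<Rightarrow> real \<Rightarrow> real" where
  "levy k t r = (if r > 0 then t / (2 * sqrt pi) * r powr (-3/2) * exp (- t\<^sup>2 / (4 * r)) *
      poly (levy_poly k) (t\<^sup>2 / (4 * r)) / t ^ k else 0)"

lemma levy_measurable [measurable (raw)]: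
  assumes [measurable]: "f \<in> borel_measurable M" "g \<in> borel_measurable M"
  shows "(\<lambda>x. levy k (f x) (g x)) \<in> borel_measurable M"
proof -
  have [measurable]: "poly p \<in> borel_measurable borel" for p :: "real poly"
    by (intro borel_measurable_continuous_onI continuous_intros)
  show ?thesis unfolding levy_def by measurable
qed

lemma levy_nonpos [simp]: "r \<le> 0 \<Longrightarrow> levy k t r = 0"
  by (simp add: levy_def)

lemma levy_0_nonneg: "t \<ge> 0 \<Longrightarrow> levy 0 t r \<ge> 0"
  by (simp add: levy_def)

lemma levy_has_derivative:
  assumes "t > 0"
  shows "((\<lambda>t. levy k t r) has_real_derivative levy (Suc k) t r) (at t)"
proof (cases "r > 0")
  case True
  define E where "E = (\<lambda>t. exp (- t\<^sup>2 / (4 * r)))"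
  define P where "P = (\<lambda>t. poly (levy_poly k) (t\<^sup>2 / (4 * r)))"
  define c where "c = r powr (-3/2) / (2 * sqrt pi)"
  have E: "(E has_real_derivative E t * (- t / (2 * r))) (at t)"
    unfolding E_def using True by (auto intro!: derivative_eq_intros simp: field_simps)
  have P: "(P has_real_derivative poly (pderiv (levy_poly k)) (t\<^sup>2 / (4 * r)) * (t / (2 * r))) (at t)"
    unfolding P_def
    by (rule DERIV_chain2[OF poly_DERIV]) (use True in \<open>auto intro!: derivative_eq_intros simp: field_simps\<close>)
  have K: "((\<lambda>t. inverse (t ^ k)) has_real_derivative - real k * inverse (t ^ Suc k)) (at t)"
    by (rule DERIV_cong[OF DERIV_inverse_fun[OF DERIV_pow]])
       (use assms in \<open>cases k; simp add: field_simps power2_eq_square\<close>)+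
  have "((\<lambda>t. c * t * E t * P t * inverse (t ^ k)) has_real_derivative
      c * E t * inverse (t ^ Suc k) * (t * P t - t\<^sup>2 / (2 * r) * t * P t +
        t\<^sup>2 / (2 * r) * t * poly (pderiv (levy_poly k)) (t\<^sup>2 / (4 * r)) - real k * t * P t)) (at t)"
    by (rule DERIV_cong[OF DERIV_mult[OF DERIV_mult[OF DERIV_mult[OF DERIV_cmult[OF DERIV_ident] E] P] K]])
       (use assms True in \<open>simp add: field_simps power2_eq_square\<close>)
  also have "(\<lambda>t. c * t * E t * P t * inverse (t ^ k)) = (\<lambda>t. levy k t r)"
    using True by (auto simp: levy_def c_def E_def P_def field_simps)
  also have "c * E t * inverse (t ^ Suc k) * (t * P t - t\<^sup>2 / (2 * r) * t * P t +
        t\<^sup>2 / (2 * r) * t * poly (pderiv (levy_poly k)) (t\<^sup>2 / (4 * r)) - real k * t * P t) = levy (Suc k) t r"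
    using True assms by (simp add: levy_def c_def E_def P_def field_simps)
  finally show ?thesis .
qed (simp add: levy_def)

lemma poly_le_exp:
  fixes p :: "real poly"
  assumes "c > 0"
  shows "\<exists>C\<ge>0. \<forall>u\<ge>0. \<bar>poly p u\<bar> \<le> C * exp (c * u)"
  using assms
proof (induction p arbitrary: c)
  case (pCons a p)
  from pCons.IH[of "c/2"] pCons.prems obtain C where
    C: "C \<ge> 0" "\<And>u. u \<ge> 0 \<Longrightarrow> \<bar>poly p u\<bar> \<le> C * exp (c/2 * u)" by auto
  have "\<bar>poly (pCons a p) u\<bar> \<le> (\<bar>a\<bar> + C * (2 / c)) * exp (c * u)" if u: "u \<ge> 0" for u
  proof -
    have "u \<le> 2 / c * exp (c/2 * u)"
      using exp_ge_add_one_self[of "c/2*u"] pCons.prems by (simp add: field_simps)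
    then have "u * \<bar>poly p u\<bar> \<le> (2 / c * exp (c/2 * u)) * (C * exp (c/2 * u))"
      by (intro mult_mono C u) (use pCons.prems C in auto)
    also have "\<dots> = C * (2 / c) * exp (c * u)"
      by (simp add: field_simps flip: exp_add)
    finally have "u * \<bar>poly p u\<bar> \<le> C * (2 / c) * exp (c * u)" .
    moreover have "\<bar>a\<bar> \<le> \<bar>a\<bar> * exp (c * u)" using u pCons.prems
      by (simp add: mult_le_cancel_left1)
    moreover have "\<bar>poly (pCons a p) u\<bar> \<le> \<bar>a\<bar> + u * \<bar>poly p u\<bar>"
      using u abs_triangle_ineq[of a "u * poly p u"] by (simp add: abs_mult)
    ultimately show ?thesis by (simp add: algebra_simps)
  qed
  then show ?case using C pCons.prems by (intro exI[of _ "\<bar>a\<bar> + C * (2 / c)"]) auto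
qed auto

text \<open>
The polynomial factor is absorbed by half of the exponential \<open>exp (- t\<^sup>2 / 4r)\<close>; the other half is
the exponential of the density with parameter \<open>t / \<surd>2\<close>.
\<close>
lemma levy_bound:
  "\<exists>C\<ge>0. \<forall>t>0. \<forall>r. \<bar>levy k t r\<bar> \<le> C / t ^ k * levy 0 (t / sqrt 2) r"
proof -
  obtain C where C: "C \<ge> 0" "\<And>u. u \<ge> 0 \<Longrightarrow> \<bar>poly (levy_poly k) u\<bar> \<le> C * exp (1/2 * u)"
    using poly_le_exp[of "1/2" "levy_poly k"] by auto
  have "\<bar>levy k t r\<bar> \<le> (C * sqrt 2) / t ^ k * levy 0 (t / sqrt 2) r" if t: "t > 0" for t r
  proof (cases "r > 0")
    case True
    let ?u = "t\<^sup>2 / (4 * r)"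
    have "\<bar>levy k t r\<bar> = t / (2 * sqrt pi) * r powr (-3/2) / t ^ k * (exp (- ?u) * \<bar>poly (levy_poly k) ?u\<bar>)"
      using True t by (simp add: levy_def abs_mult)
    also have "\<dots> \<le> t / (2 * sqrt pi) * r powr (-3/2) / t ^ k * (exp (- ?u) * (C * exp (1/2 * ?u)))"
      by (intro mult_left_mono C) (use True t in auto)
    also have "exp (- ?u) * (C * exp (1/2 * ?u)) = C * exp (- ?u / 2)"
      by (simp flip: exp_add)
    also have "t / (2 * sqrt pi) * r powr (-3/2) / t ^ k * (C * exp (- ?u / 2)) =
       (C * sqrt 2) / t ^ k * levy 0 (t / sqrt 2) r"
      using True t by (simp add: levy_def power_divide field_simps)
    finally show ?thesis .
  qed simp
  then show ?thesis using C by (intro exI[of _ "C * sqrt 2"]) auto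
qed

section \<open>Averages against the stable kernels\<close>

text \<open>
By the mean value theorem the difference quotients are bounded by the majorant \<open>w\<close> of the
derivatives, so dominated convergence applies.
\<close>
lemma has_derivative_integral_dominated:
  fixes g g' :: "real \<Rightarrow> 'a \<Rightarrow> real"
  assumes t: "t \<in> {a<..<b}"
    and int: "\<And>s. s \<in> {a<..<b} \<Longrightarrow> integrable M (g s)"
    and der: "\<And>s x. s \<in> {a<..<b} \<Longrightarrow> ((\<lambda>s. g s x) has_real_derivative g' s x) (at s)"
    and bnd: "\<And>s x. s \<in> {a<..<b} \<Longrightarrow> \<bar>g' s x\<bar> \<le> w x"
    and [measurable]: "g' t \<in> borel_measurable M" and w: "integrable M w"
  shows "((\<lambda>s. \<integral>x. g s x \<partial>M) has_real_derivative (\<integral>x. g' t x \<partial>M)) (at t)"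
proof -
  have "((\<lambda>s. ((\<integral>x. g s x \<partial>M) - (\<integral>x. g t x \<partial>M)) / (s - t)) \<longlongrightarrow> (\<integral>x. g' t x \<partial>M)) (at t within {a<..<b})"
    unfolding tendsto_at_iff_sequentially
  proof safe
    fix X :: "nat \<Rightarrow> real"
    assume X: "\<forall>i. X i \<in> {a<..<b} - {t}" and lim: "X \<longlonglongrightarrow> t"
    have Xi: "X i \<in> {a<..<b}" "X i \<noteq> t" for i using X by auto
    have eq: "((\<integral>x. g (X i) x \<partial>M) - (\<integral>x. g t x \<partial>M)) / (X i - t) =
       (\<integral>x. (g (X i) x - g t x) / (X i - t) \<partial>M)" for i
      using int[OF Xi(1)] int[OF t] by simp
    have "(\<lambda>i. \<integral>x. (g (X i) x - g t x) / (X i - t) \<partial>M) \<longlonglongrightarrow> (\<integral>x. g' t x \<partial>M)"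
    proof (rule integral_dominated_convergence[where w=w])
      show "AE x in M. (\<lambda>i. (g (X i) x - g t x) / (X i - t)) \<longlonglongrightarrow> g' t x"
      proof (rule AE_I2)
        fix x
        have "((\<lambda>s. (g s x - g t x) / (s - t)) \<longlongrightarrow> g' t x) (at t within UNIV)"
          using der[OF t, of x] by (simp add: has_field_derivative_iff)
        then show "(\<lambda>i. (g (X i) x - g t x) / (X i - t)) \<longlonglongrightarrow> g' t x"
          unfolding tendsto_at_iff_sequentially using lim Xi by (auto simp: o_def)
      qed
      show "AE x in M. norm ((g (X i) x - g t x) / (X i - t)) \<le> w x" for i
      proof (rule AE_I2)
        fix x
        have "norm (g (X i) x - g t x) \<le> w x * norm (X i - t)"
          by (rule field_differentiable_bound[where S="{a<..<b}" and f'="\<lambda>s. g' s x"])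
             (use bnd Xi t der in \<open>auto intro: has_field_derivative_at_within\<close>)
        then show "norm ((g (X i) x - g t x) / (X i - t)) \<le> w x"
          using Xi(2)[of i] by (simp add: field_simps abs_mult)
      qed
      show "(\<lambda>x. (g (X i) x - g t x) / (X i - t)) \<in> borel_measurable M" for i
        using int[OF Xi(1)[of i]] int[OF t] by measurable
    qed (use w in auto)
    then show "((\<lambda>s. ((\<integral>x. g s x \<partial>M) - (\<integral>x. g t x \<partial>M)) / (s - t)) \<circ> X) \<longlonglongrightarrow> (\<integral>x. g' t x \<partial>M)"
      unfolding o_def eq .
  qed
  then show ?thesis
    using t by (simp add: has_field_derivative_iff at_within_open[where S="{a<..<b}"])
qed

text \<open>
A majorant of the form (integrable function of \<open>x\<close>) times (kernel of bounded mass in \<open>y\<close>) covers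
both product majorants and the Markov kernels met below, which are not integrable over the product
space on their own.
\<close>
lemma Fubini_dominated:
  fixes F :: "'a::euclidean_space \<Rightarrow> 'b::euclidean_space \<Rightarrow> real"
  assumes F [measurable]: "(\<lambda>(x, y). F x y) \<in> borel_measurable (borel \<Otimes>\<^sub>M borel)"
    and a: "integrable lborel a"
    and k: "\<And>x. integrable lborel (k x)"
    and B: "\<And>x. (\<integral>y. k x y \<partial>lborel) \<le> B"
    and bnd: "\<And>x y. \<bar>F x y\<bar> \<le> a x * k x y"
    and a0: "\<And>x. 0 \<le> a x"
  shows "(\<integral>x. (\<integral>y. F x y \<partial>lborel) \<partial>lborel) = (\<integral>y. (\<integral>x. F x y \<partial>lborel) \<partial>lborel)"
proof -
  have Fm: "(\<lambda>(x, y). F x y) \<in> borel_measurable (lborel \<Otimes>\<^sub>M lborel)"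
    by (subst measurable_cong_sets[OF sets_pair_measure_cong[OF sets_lborel sets_lborel] refl]) (rule F)
  have Fx: "integrable lborel (F x)" for x
    by (rule Bochner_Integration.integrable_bound[where f="\<lambda>y. a x * k x y"])
       (use k bnd[of x] order_trans[OF _ abs_ge_self] in \<open>auto intro!: AE_I2\<close>)
  have "integrable (lborel \<Otimes>\<^sub>M lborel) (\<lambda>(x, y). F x y)"
  proof (rule lborel_pair.Fubini_integrable)
    show "integrable lborel (\<lambda>x. \<integral>y. norm (case (x, y) of (x, y) \<Rightarrow> F x y) \<partial>lborel)"
    proof (rule Bochner_Integration.integrable_bound[where f="\<lambda>x. B * a x"])
      show "integrable lborel (\<lambda>x. B * a x)" using a by simp
      show "(\<lambda>x. \<integral>y. norm (case (x, y) of (x, y) \<Rightarrow> F x y) \<partial>lborel) \<in> borel_measurable lborel"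
        by (simp, measurable)
      show "AE x in lborel. norm (\<integral>y. norm (case (x, y) of (x, y) \<Rightarrow> F x y) \<partial>lborel) \<le> norm (B * a x)"
      proof (rule AE_I2)
        fix x
        have "norm (\<integral>y. norm (F x y) \<partial>lborel) = (\<integral>y. \<bar>F x y\<bar> \<partial>lborel)" by simp
        also have "\<dots> \<le> (\<integral>y. a x * k x y \<partial>lborel)"
          by (rule integral_mono) (use Fx k bnd in auto)
        also have "\<dots> \<le> B * a x" using mult_left_mono[OF B a0, of x x] by (simp add: mult.commute)
        finally show "norm (\<integral>y. norm (case (x, y) of (x, y) \<Rightarrow> F x y) \<partial>lborel) \<le> norm (B * a x)" by simp
      qed
    qed
  qed (use Fx Fm in auto)
  from lborel_pair.Fubini_integral[OF this] show ?thesis ..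
qed

text \<open>
The substitution \<open>u = t\<^sup>2 / 4r\<close> that moves \<open>t\<close> from the argument of the semigroup into the kernel.
\<close>
lemma levy_0_change_of_variables:
  fixes h :: "real \<Rightarrow> real"
  assumes t: "t > 0" and [measurable]: "h \<in> borel_measurable borel"
  shows "set_integrable lborel {0<..} (\<lambda>u. exp (- u) / sqrt u * h (t\<^sup>2 / (4 * u))) \<longleftrightarrow>
           integrable lborel (\<lambda>r. levy 0 t r * h r)" (is "?I \<longleftrightarrow> ?J")
    and "set_integrable lborel {0<..} (\<lambda>u. exp (- u) / sqrt u * h (t\<^sup>2 / (4 * u))) \<Longrightarrow> 1 / sqrt pi * (LBINT u:{0<..}. exp (- u) / sqrt u * h (t\<^sup>2 / (4 * u))) =
           (\<integral>r. levy 0 t r * h r \<partial>lborel)"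
proof -
  define f where "f = (\<lambda>u. exp (- u) / sqrt u * h (t\<^sup>2 / (4 * u)))"
  define g where "g = (\<lambda>r::real. t\<^sup>2 / (4 * r))"
  let ?S = "{0::real<..}"
  have [measurable]: "f \<in> borel_measurable borel" unfolding f_def by measurable
  have im: "g ` ?S = ?S"
  proof (intro equalityI subsetI)
    fix y :: real assume "y \<in> ?S"
    then show "y \<in> g ` ?S" using t by (intro image_eqI[of _ _ "t\<^sup>2 / (4 * y)"]) (auto simp: g_def)
  qed (use t in \<open>auto simp: g_def\<close>)
  have inj: "inj_on g ?S" using t by (auto simp: inj_on_def g_def)
  have der: "(g has_field_derivative - t\<^sup>2 / (4 * r\<^sup>2)) (at r within ?S)" if "r \<in> ?S" for r
    unfolding g_def using that by (auto intro!: derivative_eq_intros simp: field_simps power2_eq_square)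
  have eq: "\<bar>- t\<^sup>2 / (4 * r\<^sup>2)\<bar> * f (g r) = sqrt pi * (levy 0 t r * h r)" if "r \<in> ?S" for r
  proof -
    have r: "r > 0" using that by simp
    have p: "r powr - (3/2) = sqrt r / r\<^sup>2"
    proof -
      have "r powr - (3/2) = r powr (1/2 - 2)" by simp
      also have "\<dots> = sqrt r / r\<^sup>2" unfolding powr_diff using r by (simp add: powr_half_sqrt)
      finally show ?thesis .
    qed
    have q: "t\<^sup>2 / (4 * (t\<^sup>2 / (4 * r))) = r" using r t by simp
    have "sqrt (t\<^sup>2 / (4 * r)) = t / (2 * sqrt r)"
      using r t by (simp add: real_sqrt_divide real_sqrt_mult)
    then have "\<bar>- t\<^sup>2 / (4 * r\<^sup>2)\<bar> * f (g r) = t\<^sup>2 / (4 * r\<^sup>2) * (exp (- (t\<^sup>2 / (4 * r))) * (2 * sqrt r) / t * h r)"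
      unfolding f_def g_def q by simp
    also have "\<dots> = sqrt pi * (levy 0 t r * h r)"
      using r t by (simp add: levy_def p power2_eq_square)
    finally show ?thesis .
  qed
  have lmeasurable_S: "?S \<in> sets lebesgue" by simp
  have cv: "((\<lambda>r. sqrt pi * (levy 0 t r * h r)) absolutely_integrable_on ?S \<and>
      integral ?S (\<lambda>r. sqrt pi * (levy 0 t r * h r)) = b) \<longleftrightarrow>
      (f absolutely_integrable_on ?S \<and> integral ?S f = b)" for b
  proof -
    have "(\<lambda>r. \<bar>- t\<^sup>2 / (4 * r\<^sup>2)\<bar> * f (g r)) absolutely_integrable_on ?S \<longleftrightarrow>
        (\<lambda>r. sqrt pi * (levy 0 t r * h r)) absolutely_integrable_on ?S"
      by (intro set_integrable_cong refl eq)
    moreover have "integral ?S (\<lambda>r. \<bar>- t\<^sup>2 / (4 * r\<^sup>2)\<bar> * f (g r)) =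
        integral ?S (\<lambda>r. sqrt pi * (levy 0 t r * h r))"
      by (intro Henstock_Kurzweil_Integration.integral_cong eq)
    ultimately show ?thesis
      using has_absolute_integral_change_of_variables_1'[OF lmeasurable_S der inj, of f b]
      unfolding im by (simp only:)
  qed
  have leb: "F absolutely_integrable_on ?S \<longleftrightarrow> set_integrable lborel ?S F"
    if [measurable]: "F \<in> borel_measurable borel" for F :: "real \<Rightarrow> real"
    unfolding set_integrable_def by (rule integrable_completion) simp
  have ind: "indicator ?S r *\<^sub>R (sqrt pi * (levy 0 t r * h r)) = sqrt pi * (levy 0 t r * h r)" for r
    by (cases "r > 0") (simp_all add: indicator_def)
  have levyJ: "set_integrable lborel ?S (\<lambda>r. sqrt pi * (levy 0 t r * h r)) \<longleftrightarrow> ?J"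
    unfolding set_integrable_def ind by simp
  show IJ: "?I \<longleftrightarrow> ?J"
    using cv leb[of f] leb[of "\<lambda>r. sqrt pi * (levy 0 t r * h r)"] levyJ by (auto simp: f_def)
  assume I: ?I
  have "integral ?S (\<lambda>r. sqrt pi * (levy 0 t r * h r)) = integral ?S f"
    using cv leb[of f] I by (auto simp: f_def)
  moreover have "integral ?S f = (LBINT u:?S. f u)"
    using I by (intro set_borel_integral_eq_integral(2)[symmetric]) (simp add: f_def)
  moreover have "integral ?S (\<lambda>r. sqrt pi * (levy 0 t r * h r)) = (LBINT r:?S. sqrt pi * (levy 0 t r * h r))"
    using I IJ levyJ by (intro set_borel_integral_eq_integral(2)[symmetric]) simp
  moreover have "(LBINT r:?S. sqrt pi * (levy 0 t r * h r)) = sqrt pi * (\<integral>r. levy 0 t r * h r \<partial>lborel)"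
    unfolding set_lebesgue_integral_def ind by simp
  ultimately show "1 / sqrt pi * (LBINT u:?S. exp (- u) / sqrt u * h (t\<^sup>2 / (4 * u))) =
           (\<integral>r. levy 0 t r * h r \<partial>lborel)"
    by (simp add: f_def)
qed

text \<open>
With \<open>h = 1\<close> the substitution reduces the total mass of \<open>\<mu>\<^sub>t\<close> to \<open>\<Gamma>(1/2) / \<surd>\<pi> = 1\<close>.
\<close>
lemma
  assumes t: "t > 0"
  shows integrable_levy_0: "integrable lborel (levy 0 t)"
    and integral_levy_0: "(\<integral>r. levy 0 t r \<partial>lborel) = 1"
proof -
  have hi: "((\<lambda>u::real. exp (- u) / sqrt u) has_integral sqrt pi) {0<..}"
  proof -
    have "((\<lambda>u::real. u powr (1/2 - 1) / exp u) has_integral Gamma (1/2)) {0..}"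
      by (rule Gamma_integral_real) simp
    moreover have "negligible {x \<in> {0::real..} - {0<..}. P x}" "negligible {x \<in> {0<..} - {0::real..}. P x}" for P
      by (rule negligible_subset[of "{0}"]; auto)+
    ultimately have "((\<lambda>u::real. u powr (1/2 - 1) / exp u) has_integral Gamma (1/2)) {0<..}"
      by (rule iffD1[OF has_integral_spike_set_eq, rotated 2])
    moreover have "u powr (1/2 - 1) / exp u = exp (- u) / sqrt u" if "u \<in> {0<..}" for u :: real
      using that unfolding powr_diff by (simp add: powr_half_sqrt exp_minus divide_simps)
    ultimately have "((\<lambda>u::real. exp (- u) / sqrt u) has_integral Gamma (1/2)) {0<..}"
      by (rule has_integral_eq[rotated]) simp
    then show ?thesis by (simp add: Gamma_one_half_real)
  qed
  have "(\<lambda>u::real. exp (- u) / sqrt u) absolutely_integrable_on {0<..}"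
    using hi by (intro nonnegative_absolutely_integrable_1) (auto simp: has_integral_integrable)
  then have si: "set_integrable lborel {0<..} (\<lambda>u::real. exp (- u) / sqrt u)"
    unfolding set_integrable_def by (subst (asm) integrable_completion) auto
  then show "integrable lborel (levy 0 t)"
    using levy_0_change_of_variables(1)[OF t, of "\<lambda>_. 1"] by simp
  have "(LBINT u:{0<..}. exp (- u) / sqrt u) = sqrt pi"
    using si hi by (simp add: set_borel_integral_eq_integral(2) integral_unique)
  with si show "(\<integral>r. levy 0 t r \<partial>lborel) = 1"
    using levy_0_change_of_variables(2)[OF t, of "\<lambda>_. 1"] by simp
qed

text \<open>
A majorant that is uniform for parameters \<open>s\<close> in a compact interval with left end \<open>a\<close>.
\<close>
lemma levy_0_le_rescaled:
  assumes "0 < a" "a \<le> s"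
  shows "levy 0 s r \<le> s / a * levy 0 a r"
proof (cases "r > 0")
  case True
  have "exp (- s\<^sup>2 / (4 * r)) \<le> exp (- a\<^sup>2 / (4 * r))"
    using assms True by (simp add: divide_right_mono power_mono)
  then have "s / (2 * sqrt pi) * r powr (-3/2) * exp (- s\<^sup>2 / (4 * r)) \<le>
      s / (2 * sqrt pi) * r powr (-3/2) * exp (- a\<^sup>2 / (4 * r))"
    using assms by (intro mult_left_mono) auto
  then show ?thesis using assms True by (simp add: levy_def)
qed simp

lemma integrable_levy:
  assumes t: "t > 0"
  shows "integrable lborel (levy k t)"
proof -
  obtain C where C: "C \<ge> 0" "\<And>t r. t > 0 \<Longrightarrow> \<bar>levy k t r\<bar> \<le> C / t ^ k * levy 0 (t / sqrt 2) r"
    using levy_bound[of k] by auto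
  show ?thesis
    by (rule Bochner_Integration.integrable_bound[where f="\<lambda>r. C / t ^ k * levy 0 (t / sqrt 2) r"])
       (use t order_trans[OF C(2)[OF t] abs_ge_self] in
         \<open>auto intro!: integrable_mult_right integrable_levy_0 simp del: abs_divide abs_mult\<close>)
qed

lemma integral_abs_levy_le:
  "\<exists>C\<ge>0. \<forall>t>0. (\<integral>r. \<bar>levy k t r\<bar> \<partial>lborel) \<le> C / t ^ k"
proof -
  obtain C where C: "C \<ge> 0" "\<And>t r. t > 0 \<Longrightarrow> \<bar>levy k t r\<bar> \<le> C / t ^ k * levy 0 (t / sqrt 2) r"
    using levy_bound[of k] by auto
  have "(\<integral>r. \<bar>levy k t r\<bar> \<partial>lborel) \<le> C / t ^ k" if t: "t > 0" for t
  proof -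
    have "(\<integral>r. \<bar>levy k t r\<bar> \<partial>lborel) \<le> (\<integral>r. C / t ^ k * levy 0 (t / sqrt 2) r \<partial>lborel)"
      by (rule integral_mono) (use t C integrable_levy_0[of "t / sqrt 2"] integrable_levy[OF t] in auto)
    also have "\<dots> = C / t ^ k" using t integral_levy_0[of "t / sqrt 2"] by simp
    finally show ?thesis .
  qed
  with C show ?thesis by blast
qed

lemma integrable_levy_times:
  assumes t: "t > 0" and [measurable]: "h \<in> borel_measurable borel"
    and h: "\<And>r. r > 0 \<Longrightarrow> \<bar>h r\<bar> \<le> M"
  shows "integrable lborel (\<lambda>r. levy k t r * h r)"
proof (rule Bochner_Integration.integrable_bound[where f="\<lambda>r. M * levy k t r"])
  show "AE r in lborel. norm (levy k t r * h r) \<le> norm (M * levy k t r)"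
  proof (rule AE_I2)
    fix r show "norm (levy k t r * h r) \<le> norm (M * levy k t r)"
      using mult_right_mono[OF order_trans[OF h[of r] abs_ge_self], of "\<bar>levy k t r\<bar>"]
      by (cases "r > 0") (simp_all add: abs_mult mult.commute)
  qed
  show "integrable lborel (\<lambda>r. M * levy k t r)" by (intro integrable_mult_right integrable_levy t)
  show "(\<lambda>r. levy k t r * h r) \<in> borel_measurable lborel" by measurable
qed

lemma levy_average_has_derivative:
  assumes t: "t > 0" and [measurable]: "h \<in> borel_measurable borel"
    and h: "\<And>r. r > 0 \<Longrightarrow> \<bar>h r\<bar> \<le> M"
  shows "((\<lambda>t. \<integral>r. levy k t r * h r \<partial>lborel) has_real_derivative
           (\<integral>r. levy (Suc k) t r * h r \<partial>lborel)) (at t)"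
proof -
  obtain C where C: "C \<ge> 0" "\<And>t r. t > 0 \<Longrightarrow> \<bar>levy (Suc k) t r\<bar> \<le> C / t ^ Suc k * levy 0 (t / sqrt 2) r"
    using levy_bound[of "Suc k"] by blast
  show ?thesis
  proof (rule has_derivative_integral_dominated[where a="t / 2" and b="2 * t"
       and g="\<lambda>t r. levy k t r * h r" and g'="\<lambda>t r. levy (Suc k) t r * h r"
       and w="\<lambda>r. M * (C / (t / 2) ^ Suc k * (4 * levy 0 (t / 2 / sqrt 2) r))"])
    show "t \<in> {t / 2<..<2 * t}" using t by auto
    show "integrable lborel (\<lambda>r. levy k s r * h r)" if "s \<in> {t/2<..<2*t}" for s
      using that t by (intro integrable_levy_times[OF _ _ h]) auto
    show "((\<lambda>s. levy k s r * h r) has_real_derivative levy (Suc k) s r * h r) (at s)"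
      if "s \<in> {t/2<..<2*t}" for s r
      using that t by (intro DERIV_cmult_right levy_has_derivative) auto
    show "integrable lborel (\<lambda>r. M * (C / (t / 2) ^ Suc k * (4 * levy 0 (t / 2 / sqrt 2) r)))"
      using t by (intro integrable_mult_right integrable_levy_0) auto
    show "\<bar>levy (Suc k) s r * h r\<bar> \<le> M * (C / (t / 2) ^ Suc k * (4 * levy 0 (t / 2 / sqrt 2) r))"
      if s: "s \<in> {t/2<..<2*t}" for s r
    proof (cases "r > 0")
      case True
      have s0: "s > 0" using s t by auto
      have "levy 0 (s / sqrt 2) r \<le> (s / sqrt 2) / (t / 2 / sqrt 2) * levy 0 (t / 2 / sqrt 2) r"
        by (rule levy_0_le_rescaled) (use s t divide_right_mono[of "t / 2" s "sqrt 2"] in auto)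
      also have "\<dots> \<le> 4 * levy 0 (t / 2 / sqrt 2) r"
        by (rule mult_right_mono) (use s t in \<open>auto simp: field_simps intro!: levy_0_nonneg\<close>)
      finally have l: "levy 0 (s / sqrt 2) r \<le> 4 * levy 0 (t / 2 / sqrt 2) r" .
      have "C / s ^ Suc k \<le> C / (t / 2) ^ Suc k"
        using s t C(1) by (intro divide_left_mono power_mono mult_pos_pos zero_less_power) auto
      with l have "C / s ^ Suc k * levy 0 (s / sqrt 2) r \<le> C / (t / 2) ^ Suc k * (4 * levy 0 (t / 2 / sqrt 2) r)"
        using s0 t C(1) by (intro mult_mono) (auto intro!: levy_0_nonneg)
      with C(2)[OF s0, of r] have "\<bar>levy (Suc k) s r\<bar> \<le> C / (t / 2) ^ Suc k * (4 * levy 0 (t / 2 / sqrt 2) r)" by linarith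
      then have "\<bar>levy (Suc k) s r\<bar> * \<bar>h r\<bar> \<le> C / (t / 2) ^ Suc k * (4 * levy 0 (t / 2 / sqrt 2) r) * M"
        by (intro mult_mono h True) (use C t in \<open>auto intro!: mult_nonneg_nonneg levy_0_nonneg\<close>)
      then show ?thesis by (simp add: abs_mult mult_ac)
    qed simp
  qed measurable
qed

text \<open>
The shift \<open>c\<close> lets two representations of one function of \<open>t\<close> be differentiated side by side: in
\<open>levy_average_semigroup\<close> one side depends on \<open>t\<close>, the other on \<open>c + t\<close>.
\<close>
lemma higher_deriv_levy_average:
  assumes [measurable]: "h \<in> borel_measurable borel"
    and h: "\<And>r. r > 0 \<Longrightarrow> \<bar>h r\<bar> \<le> M"
    and F: "\<And>t. t > 0 \<Longrightarrow> F t = (\<integral>r. levy j (c + t) r * h r \<partial>lborel)"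
    and c: "c \<ge> 0" and t: "t > 0"
  shows "(deriv ^^ k) F t = (\<integral>r. levy (j + k) (c + t) r * h r \<partial>lborel)"
  using t
proof (induction k arbitrary: t)
  case (Suc k)
  have ct: "c + t > 0" using c Suc.prems by simp
  have "((\<lambda>t. \<integral>r. levy (j + k) (c + t) r * h r \<partial>lborel) has_real_derivative
      (\<integral>r. levy (Suc (j + k)) (c + t) r * h r \<partial>lborel)) (at t)"
    using levy_average_has_derivative[OF ct assms(1) h] DERIV_shift[of _ _ t c] by (simp add: add.commute)
  then have "((deriv ^^ k) F has_real_derivative (\<integral>r. levy (Suc (j + k)) (c + t) r * h r \<partial>lborel)) (at t)"
    by (rule has_field_derivative_transform_within_open[where S="{0<..}"]) (use Suc in auto)
  then show ?case by (simp add: DERIV_imp_deriv)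
qed (simp add: F)

lemma levy_average_bound:
  assumes t: "t > 0" and [measurable]: "h \<in> borel_measurable borel"
    and h: "\<And>r. r > 0 \<Longrightarrow> \<bar>h r\<bar> \<le> M"
  shows "\<bar>\<integral>r. levy k t r * h r \<partial>lborel\<bar> \<le> (\<integral>r. \<bar>levy k t r\<bar> \<partial>lborel) * M"
proof -
  have "\<bar>levy k t r * h r\<bar> \<le> \<bar>levy k t r\<bar> * M" for r
    using mult_left_mono[OF h[of r], of "\<bar>levy k t r\<bar>"] by (cases "r > 0") (auto simp: abs_mult)
  then have "norm (\<integral>r. levy k t r * h r \<partial>lborel) \<le> (\<integral>r. \<bar>levy k t r\<bar> * M \<partial>lborel)"
    by (intro Bochner_Integration.integral_norm_bound_integral integrable_levy_times[OF t _ h])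
       (use integrable_levy[OF t] in auto)
  then show ?thesis by simp
qed

section \<open>Convolution of the stable kernels\<close>

lemma levy_exponent_split:
  fixes a b s t :: real
  assumes "a > 0" "b > 0"
  shows "t\<^sup>2 / (4 * a) + s\<^sup>2 / (4 * b) = (t + s)\<^sup>2 / (4 * (a + b)) + (s * a - t * b)\<^sup>2 / (4 * (a + b) * (a * b))"
proof -
  have "(t\<^sup>2 * b + s\<^sup>2 * a) * (a + b) = (t + s)\<^sup>2 * (a * b) + (s * a - t * b)\<^sup>2"
    by (simp add: algebra_simps power2_eq_square)
  then have "(t\<^sup>2 * b + s\<^sup>2 * a) * (a + b) / (4 * (a + b) * (a * b)) = ((t + s)\<^sup>2 * (a * b) + (s * a - t * b)\<^sup>2) / (4 * (a + b) * (a * b))"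
    by simp
  moreover have "(t\<^sup>2 * b + s\<^sup>2 * a) * (a + b) / (4 * (a + b) * (a * b)) = t\<^sup>2 / (4 * a) + s\<^sup>2 / (4 * b)"
  proof -
    have "a + b \<noteq> 0" using assms by simp
    then have *: "X * (a + b) / (4 * (a + b) * (a * b)) = X / (4 * (a * b))" for X
      using assms by (simp add: divide_simps)
    show ?thesis unfolding * using assms by (simp add: field_simps)
  qed
  moreover have "((t + s)\<^sup>2 * (a * b) + (s * a - t * b)\<^sup>2) / (4 * (a + b) * (a * b)) =
     (t + s)\<^sup>2 / (4 * (a + b)) + (s * a - t * b)\<^sup>2 / (4 * (a + b) * (a * b))"
    using assms by (simp add: add_divide_distrib)
  ultimately show ?thesis by metis
qed

lemma powr_minus_three_halves:
  fixes x :: real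
  assumes "x > 0"
  shows "x powr - (3/2) = 1 / (x * sqrt x)"
proof -
  have "x powr - (3/2) = x powr (- 1 - 1/2)" by simp
  also have "\<dots> = 1 / (x * sqrt x)"
    unfolding powr_diff using assms by (simp add: powr_half_sqrt powr_minus divide_simps)
  finally show ?thesis .
qed

text \<open>
For \<open>0 < r < v\<close> put \<open>w\<^sub>c(r) = (s r + c (v - r)) / (2 \<surd>v \<surd>(r (v - r)))\<close>. For \<open>c = t\<close> and for \<open>c = - t\<close>,
the sum of the two exponents is \<open>(c - s)\<^sup>2 / 4v + w\<^sub>c(r)\<^sup>2\<close>, while \<open>w\<^sub>c'\<close> is a multiple of
\<open>(s r - c (v - r)) (r (v - r))\<^bsup>-3/2\<^esup>\<close>. A linear combination of these two derivatives is
\<open>(r (v - r))\<^bsup>-3/2\<^esup>\<close>, so the integrand has an explicit primitive in terms of the error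
function. As \<open>r\<close> runs from 0 to \<open>v\<close>, \<open>w\<^sub>-\<^sub>t\<close> increases from \<open>-\<infinity>\<close> to \<open>\<infinity>\<close>, whereas \<open>w\<^sub>t\<close> tends to
\<open>\<infinity>\<close> at both ends and contributes nothing.
\<close>
lemma levy_0_convolution:
  assumes s: "s > 0" and t: "t > 0"
  shows "(\<integral>r. levy 0 t r * levy 0 s (v - r) \<partial>lborel) = levy 0 (t + s) v"
proof (cases "v > 0")
  case False
  then have "levy 0 t r * levy 0 s (v - r) = 0" for r by (cases "r > 0") auto
  then have "(\<lambda>r. levy 0 t r * levy 0 s (v - r)) = (\<lambda>_. 0)" by (rule ext)
  with False show ?thesis by (simp only: levy_nonpos) simp
next
  case v: True
  obtain \<Psi> :: "real \<Rightarrow> real" and l u where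
    \<Psi>: "\<And>w. (\<Psi> has_real_derivative exp (- w\<^sup>2)) (at w)"
    and lim: "(\<Psi> \<longlongrightarrow> l) at_bot" "(\<Psi> \<longlongrightarrow> u) at_top" and ul: "u - l = sqrt pi"
    using gaussian_antiderivative by blast
  define D where "D = (\<lambda>r. r * (v - r))"
  define w where "w = (\<lambda>c r. (s * r + c * (v - r)) / (2 * sqrt v * sqrt (D r)))"
  define X where "X = (\<lambda>r. exp (- (t\<^sup>2 / (4 * r) + s\<^sup>2 / (4 * (v - r)))))"
  define e where "e = (\<lambda>c. exp (- (c - s)\<^sup>2 / (4 * v)))"
  have Xw: "X r = e c * exp (- (w c r)\<^sup>2)" if r: "0 < r" "r < v" and c: "c\<^sup>2 = t\<^sup>2" for c r
  proof -
    have "(w c r)\<^sup>2 = (s * r - (- c) * (v - r))\<^sup>2 / (4 * (r + (v - r)) * (r * (v - r)))"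
      using r v by (simp add: w_def D_def power_divide power_mult_distrib real_sqrt_mult)
    moreover have "(- c + s)\<^sup>2 = (c - s)\<^sup>2" by (simp add: power2_eq_square algebra_simps)
    ultimately have "t\<^sup>2 / (4 * r) + s\<^sup>2 / (4 * (v - r)) = (c - s)\<^sup>2 / (4 * v) + (w c r)\<^sup>2"
      using levy_exponent_split[of r "v - r" "- c" s] r c by simp
    then show ?thesis unfolding X_def e_def by (simp add: exp_add[symmetric])
  qed
  have w': "(w c has_real_derivative sqrt v * (s * r - c * (v - r)) / (4 * D r * sqrt (D r))) (at r)"
    if r: "0 < r" "r < v" for c r
  proof -
    have D0: "D r > 0" using r by (simp add: D_def)
    have dD: "(D has_real_derivative v - 2 * r) (at r)"
      unfolding D_def by (auto intro!: derivative_eq_intros)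
    have dq: "((\<lambda>r. sqrt (D r)) has_real_derivative inverse (sqrt (D r)) / 2 * (v - 2 * r)) (at r)"
      by (rule DERIV_chain2[OF DERIV_real_sqrt dD]) (fact D0)
    have dn: "((\<lambda>r. s * r + c * (v - r)) has_real_derivative s - c) (at r)"
      by (auto intro!: derivative_eq_intros)
    define q where "q = sqrt (D r)"
    define y where "y = sqrt v"
    have q: "q > 0" "q * q = r * (v - r)" "q * q = D r" using D0 by (auto simp: q_def D_def)
    have y: "y > 0" "y * y = v" using v by (auto simp: y_def)
    have num: "(s - c) * (q * q) - (s * r + c * (v - r)) * ((v - 2 * r) / 2) = y * y * (s * r - c * (v - r)) / 2"
      unfolding q(2) y(2) by (simp add: field_simps)
    have "((s - c) * (2 * y * q) - N * (2 * y * (inverse q / 2 * m))) / ((2 * y * q) * (2 * y * q))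
       = ((s - c) * (q * q) - N * (m / 2)) / (2 * y * (q * q) * q)" for N m
      using q(1) y(1) by (simp add: field_simps)
    from this[of "s * r + c * (v - r)" "v - 2 * r"]
    have "((s - c) * (2 * y * q) - (s * r + c * (v - r)) * (2 * y * (inverse q / 2 * (v - 2 * r)))) / ((2 * y * q) * (2 * y * q))
       = ((s - c) * (q * q) - (s * r + c * (v - r)) * ((v - 2 * r) / 2)) / (2 * y * (q * q) * q)" .
    also have "\<dots> = y * (s * r - c * (v - r)) / (4 * (q * q) * q)"
      unfolding num using q(1) y(1) by (simp add: divide_simps)
    finally have fin: "((s - c) * (2 * y * q) - (s * r + c * (v - r)) * (2 * y * (inverse q / 2 * (v - 2 * r)))) / ((2 * y * q) * (2 * y * q))
       = y * (s * r - c * (v - r)) / (4 * D r * q)" unfolding q(3) .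
    show ?thesis
      unfolding w_def
    proof (rule DERIV_cong[OF DERIV_divide[OF dn DERIV_cmult[OF dq]]])
      show "2 * sqrt v * sqrt (D r) \<noteq> 0" using q(1) y(1) by (simp add: q_def y_def)
    qed (fact fin[unfolded q_def y_def])
  qed
  \<comment> \<open>The coefficients solve \<open>\<alpha> (s r + t (v - r)) + \<beta> (s r - t (v - r)) = 1\<close> for all \<open>r\<close>.\<close>
  define \<alpha> where "\<alpha> = (1 / s + 1 / t) / (2 * v)"
  define \<beta> where "\<beta> = (1 / s - 1 / t) / (2 * v)"
  define K where "K = t * s / (pi * sqrt v)"
  define F where "F = (\<lambda>r. K * (\<alpha> * e (- t) * \<Psi> (w (- t) r) + \<beta> * e t * \<Psi> (w t r)))"
  define f where "f = (\<lambda>r. t * s / (4 * pi) * X r / (D r * sqrt (D r)))"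
  have f_eq: "levy 0 t r * levy 0 s (v - r) = indicator {0<..<v} r * f r" for r
  proof (cases "0 < r \<and> r < v")
    case True
    have gen: "(t / (2 * P) * (1 / (a * A)) * e1) * (s / (2 * P) * (1 / (b * B)) * e2) =
        t * s / (4 * (P * P)) * (e1 * e2) / ((a * b) * (A * B))" for P a b A B e1 e2 :: real
      by (simp add: ac_simps)
    have "exp (- t\<^sup>2 / (4 * r)) * exp (- s\<^sup>2 / (4 * (v - r))) = X r"
      unfolding X_def by (simp flip: exp_add)
    moreover have "levy 0 t r = t / (2 * sqrt pi) * (1 / (r * sqrt r)) * exp (- t\<^sup>2 / (4 * r))"
      "levy 0 s (v - r) = s / (2 * sqrt pi) * (1 / ((v - r) * sqrt (v - r))) * exp (- s\<^sup>2 / (4 * (v - r)))"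
      using True by (simp_all add: levy_def powr_minus_three_halves)
    ultimately have "levy 0 t r * levy 0 s (v - r) = f r"
      unfolding f_def D_def by (simp only: gen real_sqrt_mult real_sqrt_mult_self) simp
    then show ?thesis using True by simp
  qed auto
  have F': "(F has_real_derivative f r) (at r)" if r: "0 < r" "r < v" for r
  proof -
    have D0: "D r > 0" using r by (simp add: D_def)
    have 1: "((\<lambda>r. \<Psi> (w c r)) has_real_derivative exp (- (w c r)\<^sup>2) * (sqrt v * (s * r - c * (v - r)) / (4 * D r * sqrt (D r)))) (at r)" for c
      by (rule DERIV_chain2[OF \<Psi> w'[OF r]])
    have comb: "\<alpha> * (s * r + t * (v - r)) + \<beta> * (s * r - t * (v - r)) = 1"
      using s t v by (simp add: \<alpha>_def \<beta>_def field_simps)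
    have "K * (\<alpha> * e (- t) * (exp (- (w (- t) r)\<^sup>2) * (sqrt v * (s * r - (- t) * (v - r)) / (4 * D r * sqrt (D r)))) +
        \<beta> * e t * (exp (- (w t r)\<^sup>2) * (sqrt v * (s * r - t * (v - r)) / (4 * D r * sqrt (D r)))))
      = K * sqrt v * X r * (\<alpha> * (s * r + t * (v - r)) + \<beta> * (s * r - t * (v - r))) / (4 * D r * sqrt (D r))"
      using Xw[OF r, of t] Xw[OF r, of "- t"] D0 by (simp add: field_simps)
    also have "\<dots> = f r"
      unfolding comb using v by (simp add: K_def f_def)
    finally show ?thesis unfolding F_def
      by (intro DERIV_cong[OF DERIV_cmult[OF DERIV_add[OF DERIV_cmult[OF 1] DERIV_cmult[OF 1]]]]) 
  qed
  have cD: "isCont D r" for r unfolding D_def by (intro continuous_intros)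
  have wr: "filterlim (w c) at_top (at_left v)" for c
  proof -
    have "((\<lambda>r. 2 * sqrt v * sqrt (D r)) \<longlongrightarrow> 2 * sqrt v * sqrt (D v)) (at_left v)"
      unfolding D_def by (intro tendsto_intros)
    moreover have "eventually (\<lambda>r. 0 < 2 * sqrt v * sqrt (D r)) (at_left v)"
      using eventually_at_left_real[OF v] by eventually_elim (use v in \<open>auto simp: D_def\<close>)
    ultimately have i: "filterlim (\<lambda>r. inverse (2 * sqrt v * sqrt (D r))) at_top (at_left v)"
      by (intro filterlim_inverse_at_top) (auto simp: D_def)
    have n: "((\<lambda>r. s * r + c * (v - r)) \<longlongrightarrow> s * v + c * (v - v)) (at_left v)"
      by (intro tendsto_intros)
    show ?thesis unfolding w_def divide_inverse
      by (rule filterlim_tendsto_pos_mult_at_top[OF n _ i]) (use s v in auto)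
  qed
  have i0: "filterlim (\<lambda>r. inverse (2 * sqrt v * sqrt (D r))) at_top (at_right 0)"
  proof -
    have "((\<lambda>r. 2 * sqrt v * sqrt (D r)) \<longlongrightarrow> 2 * sqrt v * sqrt (D 0)) (at_right 0)"
      unfolding D_def by (intro tendsto_intros)
    moreover have "eventually (\<lambda>r. 0 < 2 * sqrt v * sqrt (D r)) (at_right 0)"
      using eventually_at_right_real[OF v] by eventually_elim (use v in \<open>auto simp: D_def\<close>)
    ultimately show ?thesis
      by (intro filterlim_inverse_at_top) (auto simp: D_def)
  qed
  have n0: "((\<lambda>r. s * r + c * (v - r)) \<longlongrightarrow> s * 0 + c * (v - 0)) (at_right 0)" for c
    by (intro tendsto_intros)
  have w0: "filterlim (w t) at_top (at_right 0)" "filterlim (w (- t)) at_bot (at_right 0)"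
    unfolding w_def divide_inverse
    by (rule filterlim_tendsto_pos_mult_at_top[OF n0 _ i0], use t v in simp)
       (rule filterlim_tendsto_neg_mult_at_bot[OF n0 _ i0], use t v in simp)
  have A: "(F \<longlongrightarrow> K * (\<alpha> * e (- t) * l + \<beta> * e t * u)) (at_right 0)"
    unfolding F_def
    by (intro tendsto_intros filterlim_compose[OF lim(1) w0(2)] filterlim_compose[OF lim(2) w0(1)])
  have B: "(F \<longlongrightarrow> K * (\<alpha> * e (- t) * u + \<beta> * e t * u)) (at_left v)"
    unfolding F_def by (intro tendsto_intros filterlim_compose[OF lim(2) wr])
  have fc: "isCont f r" if "0 < r" "r < v" for r
    unfolding f_def X_def using that cD by (intro continuous_intros) (auto simp: D_def)
  have "(LBINT r=ereal 0..ereal v. f r) =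
      K * (\<alpha> * e (- t) * u + \<beta> * e t * u) - K * (\<alpha> * e (- t) * l + \<beta> * e t * u)"
  proof (rule interval_integral_FTC_nonneg(2))
    show "AE r in lborel. ereal 0 < ereal r \<longrightarrow> ereal r < ereal v \<longrightarrow> 0 \<le> f r"
      using s t by (auto intro!: AE_I2 simp: f_def X_def D_def)
  qed (use v F' fc A B in \<open>auto simp: ereal_tendsto_simps\<close>)
  also have "\<dots> = K * \<alpha> * e (- t) * (u - l)" by (simp add: algebra_simps)
  also have "\<dots> = levy 0 (t + s) v"
  proof -
    have e1: "e (- t) = exp (- (t + s)\<^sup>2 / (4 * v))"
      by (simp add: e_def power2_eq_square algebra_simps)
    have pp: "sqrt pi / pi = 1 / sqrt pi" using real_sqrt_mult_self[of pi] by (simp add: divide_simps)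
    have "K * \<alpha> * e (- t) * sqrt pi = t * s / sqrt v * \<alpha> * e (- t) * (sqrt pi / pi)"
      by (simp add: K_def)
    also have "t * s / sqrt v * \<alpha> = (t + s) / (2 * v * sqrt v)"
      unfolding \<alpha>_def using s t v by (simp add: divide_simps)
    finally show ?thesis unfolding ul pp using v e1
      by (simp add: levy_def powr_minus_three_halves)
  qed
  also have "(LBINT r=ereal 0..ereal v. f r) = (\<integral>r. levy 0 t r * levy 0 s (v - r) \<partial>lborel)"
    unfolding f_eq interval_lebesgue_integral_def set_lebesgue_integral_def using v by (simp add: einterval_eq)
  finally show ?thesis by simp
qed

lemma levy_average_swap:
  assumes a: "a > 0" and s: "s > 0" and [measurable]: "h \<in> borel_measurable borel"
    and h: "\<And>r. r > 0 \<Longrightarrow> \<bar>h r\<bar> \<le> M"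
  shows "(\<integral>q. levy k a q * (\<integral>r. levy j s r * h (q + r) \<partial>lborel) \<partial>lborel) =
         (\<integral>r. levy j s r * (\<integral>q. levy k a q * h (r + q) \<partial>lborel) \<partial>lborel)"
proof -
  have M: "M \<ge> 0" using order_trans[OF abs_ge_zero h[of 1]] by simp
  have "(\<integral>q. (\<integral>r. levy k a q * (levy j s r * h (q + r)) \<partial>lborel) \<partial>lborel) =
        (\<integral>r. (\<integral>q. levy k a q * (levy j s r * h (q + r)) \<partial>lborel) \<partial>lborel)"
  proof (rule Fubini_dominated[where a="\<lambda>q. \<bar>levy k a q\<bar>" and k="\<lambda>q r. \<bar>levy j s r\<bar> * M"])
    show "\<bar>levy k a q * (levy j s r * h (q + r))\<bar> \<le> \<bar>levy k a q\<bar> * (\<bar>levy j s r\<bar> * M)" for q r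
    proof (cases "q > 0 \<and> r > 0")
      case True
      then show ?thesis unfolding abs_mult by (intro mult_left_mono h) auto
    qed (use M in auto)
    show "(\<integral>r. \<bar>levy j s r\<bar> * M \<partial>lborel) \<le> (\<integral>r. \<bar>levy j s r\<bar> * M \<partial>lborel)" ..
  qed (use integrable_levy a s in auto)
  moreover have "levy k a q * (levy j s r * h (q + r)) = levy j s r * (levy k a q * h (r + q))" for q r
    by (simp add: add.commute)
  then have "(\<integral>r. (\<integral>q. levy k a q * (levy j s r * h (q + r)) \<partial>lborel) \<partial>lborel) =
      (\<integral>r. levy j s r * (\<integral>q. levy k a q * h (r + q) \<partial>lborel) \<partial>lborel)"
    by (simp only: integral_mult_right_zero)
  ultimately show ?thesis by simp
qed

text \<open>
The convolution identity tested against \<open>h\<close>, after the translation \<open>v = r + q\<close> of the inner variable.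
\<close>
lemma levy_0_average_semigroup:
  assumes a: "a > 0" and s: "s > 0" and [measurable]: "h \<in> borel_measurable borel"
    and h: "\<And>r. r > 0 \<Longrightarrow> \<bar>h r\<bar> \<le> M"
  shows "(\<integral>r. levy 0 a r * (\<integral>q. levy 0 s q * h (r + q) \<partial>lborel) \<partial>lborel) =
         (\<integral>v. levy 0 (a + s) v * h v \<partial>lborel)"
proof -
  have M: "M \<ge> 0" using order_trans[OF abs_ge_zero h[of 1]] by simp
  have shift: "(\<integral>q. levy 0 s q * h (r + q) \<partial>lborel) = (\<integral>v. levy 0 s (v - r) * h v \<partial>lborel)" for r
    by (subst (2) lborel_integral_real_affine[where c=1 and t=r]) auto
  have ks: "integrable lborel (\<lambda>v. levy 0 s (v - r))" "(\<integral>v. levy 0 s (v - r) \<partial>lborel) = 1" for r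
    using integrable_levy_0[OF s] integral_levy_0[OF s]
      lborel_integrable_real_affine[of "levy 0 s" 1 "- r"] lborel_integral_real_affine[of 1 "levy 0 s" "- r"]
    by (simp_all add: algebra_simps)
  have "(\<integral>r. (\<integral>v. levy 0 a r * (levy 0 s (v - r) * h v) \<partial>lborel) \<partial>lborel) =
        (\<integral>v. (\<integral>r. levy 0 a r * (levy 0 s (v - r) * h v) \<partial>lborel) \<partial>lborel)"
  proof (rule Fubini_dominated[where a="\<lambda>r. levy 0 a r" and k="\<lambda>r v. levy 0 s (v - r) * M" and B=M])
    show "\<bar>levy 0 a r * (levy 0 s (v - r) * h v)\<bar> \<le> levy 0 a r * (levy 0 s (v - r) * M)" for r v
    proof (cases "r > 0 \<and> v > r")
      case True
      then have "\<bar>h v\<bar> \<le> M" by (intro h) auto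
      then show ?thesis unfolding abs_mult using a s by (simp add: levy_0_nonneg mult_left_mono)
    qed auto
  qed (use ks M integrable_levy_0[OF a] levy_0_nonneg a in auto)
  also have "(\<integral>r. (\<integral>v. levy 0 a r * (levy 0 s (v - r) * h v) \<partial>lborel) \<partial>lborel) =
      (\<integral>r. levy 0 a r * (\<integral>q. levy 0 s q * h (r + q) \<partial>lborel) \<partial>lborel)"
    unfolding shift by simp
  also have "(\<integral>v. (\<integral>r. levy 0 a r * (levy 0 s (v - r) * h v) \<partial>lborel) \<partial>lborel) =
      (\<integral>v. (\<integral>r. levy 0 a r * levy 0 s (v - r) \<partial>lborel) * h v \<partial>lborel)"
    by (simp add: mult.assoc[symmetric])
  also have "\<dots> = (\<integral>v. levy 0 (a + s) v * h v \<partial>lborel)"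
    by (simp add: levy_0_convolution[OF s a])
  finally show ?thesis .
qed

text \<open>
Differentiate the case \<open>j = k = 0\<close> first \<open>k\<close> times in \<open>s\<close>, then, after exchanging the two
integrations, \<open>j\<close> times in \<open>a\<close>. At each stage both sides are averages of a bounded function, so their
derivatives are known.
\<close>
lemma levy_average_semigroup:
  assumes a: "a > 0" and s: "s > 0" and h_m [measurable]: "h \<in> borel_measurable borel"
    and h: "\<And>r. r > 0 \<Longrightarrow> \<bar>h r\<bar> \<le> M"
  shows "(\<integral>r. levy j a r * (\<integral>q. levy k s q * h (r + q) \<partial>lborel) \<partial>lborel) =
         (\<integral>v. levy (j + k) (a + s) v * h v \<partial>lborel)"
proof -
  have bnd: "\<bar>\<integral>q. levy i u q * h (r + q) \<partial>lborel\<bar> \<le> (\<integral>q. \<bar>levy i u q\<bar> \<partial>lborel) * M"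
    if "u > 0" "r > 0" for i u r
    using that by (intro levy_average_bound h) auto
  have one: "(\<integral>q. levy k s q * (\<integral>r. levy 0 a r * h (q + r) \<partial>lborel) \<partial>lborel) =
        (\<integral>v. levy k (a + s) v * h v \<partial>lborel)" if a: "a > 0" for a
  proof -
    let ?F = "\<lambda>s. \<integral>q. levy 0 s q * (\<integral>r. levy 0 a r * h (q + r) \<partial>lborel) \<partial>lborel"
    have "(deriv ^^ k) ?F s = (\<integral>q. levy (0 + k) (0 + s) q * (\<integral>r. levy 0 a r * h (q + r) \<partial>lborel) \<partial>lborel)"
      by (rule higher_deriv_levy_average[OF _ bnd[OF a]]) (use s in auto)
    moreover have "(deriv ^^ k) ?F s = (\<integral>v. levy (0 + k) (a + s) v * h v \<partial>lborel)"
      by (rule higher_deriv_levy_average[OF h_m h])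
         (use a s in \<open>auto simp: levy_0_average_semigroup[OF _ a h_m h] add.commute\<close>)
    ultimately show ?thesis by simp
  qed
  let ?G = "\<lambda>a. \<integral>r. levy 0 a r * (\<integral>q. levy k s q * h (r + q) \<partial>lborel) \<partial>lborel"
  have "(deriv ^^ j) ?G a = (\<integral>r. levy (0 + j) (0 + a) r * (\<integral>q. levy k s q * h (r + q) \<partial>lborel) \<partial>lborel)"
    by (rule higher_deriv_levy_average[OF _ bnd[OF s]]) (use a in auto)
  moreover have "(deriv ^^ j) ?G a = (\<integral>v. levy (k + j) (s + a) v * h v \<partial>lborel)"
    by (rule higher_deriv_levy_average[OF h_m h])
       (use a s in \<open>auto simp: levy_average_swap[OF _ s h_m h] one[symmetric] add.commute\<close>)
  ultimately show ?thesis by (simp add: add.commute)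
qed

section \<open>The Mehler kernel\<close>

lemma gaussian_has_bochner_integral:
  fixes c :: "'a::euclidean_space"
  assumes k: "k > 0"
  shows "has_bochner_integral lborel (\<lambda>y. exp (- (k * (norm (y - c))\<^sup>2))) ((pi / k) powr (real DIM('a) / 2))"
proof (rule has_bochner_integral_nn_integral)
  have one: "(\<integral>\<^sup>+x. ennreal (exp (- (k * (x - m)\<^sup>2))) \<partial>lborel) = ennreal (sqrt (pi / k))" for m :: real
  proof -
    define \<sigma> where "\<sigma> = sqrt (1 / (2 * k))"
    have s: "\<sigma> > 0" "\<sigma>\<^sup>2 = 1 / (2 * k)" using k by (auto simp: \<sigma>_def)
    have "exp (- (k * (x - m)\<^sup>2)) = sqrt (pi / k) * normal_density m \<sigma> x" for x
      using k unfolding normal_density_def s(2) by (simp add: mult.commute)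
    then have "(\<integral>\<^sup>+x. ennreal (exp (- (k * (x - m)\<^sup>2))) \<partial>lborel) =
        ennreal (\<integral>x. sqrt (pi / k) * normal_density m \<sigma> x \<partial>lborel)"
      using s(1) k by (simp only:) (intro nn_integral_eq_integral, auto)
    then show ?thesis using s(1) by simp
  qed
  have "exp (- (k * (norm (y - c))\<^sup>2)) = (\<Prod>b\<in>Basis. exp (- (k * (y \<bullet> b - c \<bullet> b)\<^sup>2)))" for y
  proof -
    have "(norm (y - c))\<^sup>2 = (\<Sum>b\<in>Basis. (y \<bullet> b - c \<bullet> b)\<^sup>2)"
      unfolding power2_norm_eq_inner by (subst euclidean_inner) (simp add: inner_diff_left power2_eq_square)
    then show ?thesis by (simp add: sum_distrib_left sum_negf flip: exp_sum)
  qed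
  then have "(\<integral>\<^sup>+y. ennreal (exp (- (k * (norm (y - c))\<^sup>2))) \<partial>lborel) =
      (\<integral>\<^sup>+y. (\<Prod>b\<in>Basis. ennreal (exp (- (k * (y \<bullet> b - c \<bullet> b)\<^sup>2)))) \<partial>lborel)"
    by (simp add: prod_ennreal)
  also have "\<dots> = (\<Prod>b\<in>(Basis::'a set). \<integral>\<^sup>+x. ennreal (exp (- (k * (x - c \<bullet> b)\<^sup>2))) \<partial>lborel)"
    by (rule nn_integral_lborel_prod) auto
  also have "\<dots> = ennreal (sqrt (pi / k) ^ DIM('a))"
    using k by (simp add: one ennreal_power)
  also have "sqrt (pi / k) ^ DIM('a) = (pi / k) powr (real DIM('a) / 2)"
    using k by (simp add: powr_half_sqrt[symmetric] powr_powr flip: powr_realpow)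
  finally show "(\<integral>\<^sup>+y. ennreal (exp (- (k * (norm (y - c))\<^sup>2))) \<partial>lborel) = ennreal ((pi / k) powr (real DIM('a) / 2))" .
qed auto

definition mehler :: "real \<Rightarrow> 'a::euclidean_space \<Rightarrow> 'a \<Rightarrow> real" where
  "mehler r x y = 1 / (pi powr (real DIM('a) / 2) * (1 - exp (- 2 * r)) powr (real DIM('a) / 2)) *
     exp (- ((norm (y - exp (- r) *\<^sub>R x))\<^sup>2 / (1 - exp (- 2 * r))))"

lemma mehler_nonneg: "mehler r x y \<ge> 0"
  by (simp add: mehler_def)

lemma mehler_measurable [measurable (raw)]:
  assumes [measurable]: "r \<in> borel_measurable M" "f \<in> borel_measurable M" "g \<in> borel_measurable M"
  shows "(\<lambda>x. mehler (r x) (f x) (g x)) \<in> borel_measurable M"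
  unfolding mehler_def by measurable

lemma mehler_mass:
  fixes x :: "'a::euclidean_space"
  assumes r: "r > 0"
  shows "has_bochner_integral lborel (mehler r x) 1"
proof -
  define A where "A = 1 - exp (- 2 * r)"
  have A: "A > 0" using r by (simp add: A_def)
  have "has_bochner_integral lborel (\<lambda>y. 1 / (pi powr (real DIM('a) / 2) * A powr (real DIM('a) / 2)) *
      exp (- (1 / A * (norm (y - exp (- r) *\<^sub>R x))\<^sup>2)))
      (1 / (pi powr (real DIM('a) / 2) * A powr (real DIM('a) / 2)) * (pi / (1 / A)) powr (real DIM('a) / 2))"
    by (intro has_bochner_integral_mult_right gaussian_has_bochner_integral) (use A in auto)
  moreover have "1 / (pi powr (real DIM('a) / 2) * A powr (real DIM('a) / 2)) * (pi / (1 / A)) powr (real DIM('a) / 2) = 1"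
    using A by (simp add: powr_mult)
  ultimately show ?thesis unfolding mehler_def[abs_def] A_def[symmetric] by simp
qed

text \<open>
The Gaussian convolution identity at the level of exponents. It will be used with \<open>A = 1 - e\<^bsup>-2r\<^esup>\<close>,
\<open>B = 1 - e\<^bsup>-2q\<^esup>\<close> and \<open>b = e\<^bsup>-q\<^esup>\<close>, for which \<open>C = 1 - e\<^bsup>-2(r+q)\<^esup>\<close>.
\<close>
lemma complete_square:
  fixes z y :: "'a::euclidean_space"
  assumes A: "A > 0" and B: "B > 0" and C: "C = B + b\<^sup>2 * A"
  shows "(norm z)\<^sup>2 / A + (norm (y - b *\<^sub>R z))\<^sup>2 / B =
    (norm y)\<^sup>2 / C + C / (A * B) * (norm (z - (b * A / C) *\<^sub>R y))\<^sup>2"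
proof -
  have C0: "C > 0" using A B C by (simp add: add_pos_nonneg)
  define p m n where "p = z \<bullet> z" and "m = z \<bullet> y" and "n = y \<bullet> y"
  have 1: "(norm (y - b *\<^sub>R z))\<^sup>2 = n - 2 * b * m + b\<^sup>2 * p"
    unfolding power2_norm_eq_inner
    by (simp add: inner_diff_left inner_diff_right p_def m_def n_def inner_commute[of y z] power2_eq_square algebra_simps)
  have 2: "(norm (z - c *\<^sub>R y))\<^sup>2 = p - 2 * c * m + c\<^sup>2 * n" for c
    unfolding power2_norm_eq_inner
    by (simp add: inner_diff_left inner_diff_right p_def m_def n_def inner_commute[of y z] power2_eq_square algebra_simps)
  have "C / (A * B) * (p - 2 * (b * A / C) * m + (b * A / C)\<^sup>2 * n) = C * p / (A * B) - 2 * b * m / B + b\<^sup>2 * A * n / (B * C)"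
    using A B C0 by (simp add: field_simps power2_eq_square)
  moreover have "C * p / (A * B) = p / A + b\<^sup>2 * p / B"
    using A B unfolding C by (simp add: field_simps)
  moreover have "n / C + b\<^sup>2 * A * n / (B * C) = n / B"
  proof -
    have "n / C + b\<^sup>2 * A * n / (B * C) = C * n / (B * C)"
      using B C0 by (simp add: C distrib_right add_divide_distrib)
    then show ?thesis using C0 by simp
  qed
  ultimately show ?thesis
    unfolding 1 2 unfolding p_def[symmetric] n_def[symmetric] power2_norm_eq_inner
    by (simp add: add_divide_distrib diff_divide_distrib)
qed

lemma mehler_chapman_kolmogorov:
  fixes x y :: "'a::euclidean_space"
  assumes r: "r > 0" and q: "q > 0"
  shows "has_bochner_integral lborel (\<lambda>z. mehler r x z * mehler q z y) (mehler (r + q) x y)"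
proof -
  define d where "d = real DIM('a) / 2"
  define a where "a = exp (- r)"
  define b where "b = exp (- q)"
  define A where "A = 1 - exp (- 2 * r)"
  define B where "B = 1 - exp (- 2 * q)"
  define C where "C = 1 - exp (- 2 * (r + q))"
  have A: "A > 0" and B: "B > 0" and C0: "C > 0" using r q by (auto simp: A_def B_def C_def)
  have C: "C = B + b\<^sup>2 * A"
    by (simp add: A_def B_def C_def b_def algebra_simps power2_eq_square flip: exp_add)
  have ab: "exp (- (r + q)) = b * a" by (simp add: a_def b_def flip: exp_add)
  define w where "w = y - (b * a) *\<^sub>R x"
  define c where "c = a *\<^sub>R x + (b * A / C) *\<^sub>R w"
  define K where "K = 1 / (pi powr d * A powr d) * (1 / (pi powr d * B powr d)) * exp (- ((norm w)\<^sup>2 / C))"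
  have eq: "mehler r x z * mehler q z y = K * exp (- (C / (A * B) * (norm (z - c))\<^sup>2))" for z
  proof -
    have yb: "y - b *\<^sub>R z = w - b *\<^sub>R (z - a *\<^sub>R x)" by (simp add: w_def algebra_simps)
    have zc: "z - c = (z - a *\<^sub>R x) - (b * A / C) *\<^sub>R w" by (simp add: c_def)
    have e: "(norm (z - a *\<^sub>R x))\<^sup>2 / A + (norm (y - b *\<^sub>R z))\<^sup>2 / B =
        (norm w)\<^sup>2 / C + C / (A * B) * (norm (z - c))\<^sup>2"
      unfolding yb zc by (rule complete_square[OF A B C])
    have ex: "exp (- (u + v)) = exp (- u) * exp (- v)" for u v :: real by (simp flip: exp_add)
    have "mehler r x z * mehler q z y = 1 / (pi powr d * A powr d) * (1 / (pi powr d * B powr d)) *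
        exp (- ((norm (z - a *\<^sub>R x))\<^sup>2 / A + (norm (y - b *\<^sub>R z))\<^sup>2 / B))"
      unfolding mehler_def a_def[symmetric] b_def[symmetric] A_def[symmetric] B_def[symmetric] d_def[symmetric] ex
      by (simp only: ac_simps)
    then show ?thesis unfolding e K_def ex by (simp only: ac_simps)
  qed
  have "has_bochner_integral lborel (\<lambda>z. K * exp (- (C / (A * B) * (norm (z - c))\<^sup>2))) (K * (pi / (C / (A * B))) powr d)"
    unfolding d_def by (intro has_bochner_integral_mult_right gaussian_has_bochner_integral) (use A B C0 in auto)
  also have "K * (pi / (C / (A * B))) powr d = mehler (r + q) x y"
  proof -
    have "(pi / (C / (A * B))) powr d = pi powr d * A powr d * B powr d / C powr d"
      using A B C0 by (simp add: powr_mult powr_divide)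
    then show ?thesis
      unfolding mehler_def K_def ab C_def[symmetric] d_def[symmetric] w_def[symmetric]
      using A B by simp
  qed
  finally show ?thesis unfolding eq .
qed

section \<open>The Ornstein-Uhlenbeck semigroup on bounded functions\<close>

lemma integrable_mehler: "r > 0 \<Longrightarrow> integrable lborel (mehler r x)"
  and integral_mehler: "r > 0 \<Longrightarrow> (\<integral>y. mehler r x y \<partial>lborel) = 1"
  using mehler_mass[of r x] by (auto simp: has_bochner_integral_iff)

lemma ornstein_uhlenbeck_eq_mehler:
  "r > 0 \<Longrightarrow> ornstein_uhlenbeck r f x = (\<integral>y. mehler r x y * f y \<partial>lborel)"
  by (simp add: ornstein_uhlenbeck_def mehler_def mult.assoc)

lemma ornstein_uhlenbeck_measurable [measurable (raw)]:
  assumes [measurable]: "f \<in> borel_measurable borel" "r \<in> borel_measurable M" "g \<in> borel_measurable M"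
  shows "(\<lambda>x. ornstein_uhlenbeck (r x) f (g x)) \<in> borel_measurable M"
  unfolding ornstein_uhlenbeck_def by measurable

lemma integrable_mehler_times:
  assumes r: "r > 0" and [measurable]: "f \<in> borel_measurable borel"
    and f: "AE y in lborel. \<bar>f y\<bar> \<le> M"
  shows "integrable lborel (\<lambda>y. mehler r x y * f y)"
proof (rule Bochner_Integration.integrable_bound)
  show "integrable lborel (\<lambda>y. mehler r x y * M)" using integrable_mehler[OF r, of x] by simp
  show "AE y in lborel. norm (mehler r x y * f y) \<le> norm (mehler r x y * M)"
    using f
  proof eventually_elim
    case (elim y)
    then show ?case
      using mult_left_mono[OF order_trans[OF elim abs_ge_self] mehler_nonneg[of r x y]]
      by (simp add: abs_mult mehler_nonneg)
  qed
qed measurable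

lemma ornstein_uhlenbeck_bound:
  assumes r: "r > 0" and m: "f \<in> borel_measurable borel"
    and f: "AE y in lborel. \<bar>f y\<bar> \<le> M"
  shows "\<bar>ornstein_uhlenbeck r f x\<bar> \<le> M"
proof -
  have "norm (\<integral>y. mehler r x y * f y \<partial>lborel) \<le> (\<integral>y. norm (mehler r x y * f y) \<partial>lborel)"
    by (rule integral_norm_bound)
  also have "\<dots> \<le> (\<integral>y. mehler r x y * M \<partial>lborel)"
  proof (rule integral_mono_AE)
    show "AE y in lborel. norm (mehler r x y * f y) \<le> mehler r x y * M"
      using f by eventually_elim (simp add: abs_mult mehler_nonneg mult_left_mono)
  qed (use integrable_mehler_times[OF r m f] integrable_mehler[OF r, of x] in auto)
  also have "\<dots> = M" using integral_mehler[OF r, of x] by simp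
  finally show ?thesis unfolding ornstein_uhlenbeck_eq_mehler[OF r] by simp
qed

lemma ornstein_uhlenbeck_integral:
  fixes g :: "real \<Rightarrow> 'a::euclidean_space \<Rightarrow> real"
  assumes r: "r > 0" and [measurable]: "(\<lambda>(s, y). g s y) \<in> borel_measurable (borel \<Otimes>\<^sub>M borel)"
    and w: "integrable lborel w" and g: "\<And>s y. w s \<noteq> 0 \<Longrightarrow> \<bar>g s y\<bar> \<le> M" and M: "M \<ge> 0"
  shows "ornstein_uhlenbeck r (\<lambda>y. \<integral>s. w s * g s y \<partial>lborel) x =
         (\<integral>s. w s * ornstein_uhlenbeck r (g s) x \<partial>lborel)"
proof -
  have [measurable]: "w \<in> borel_measurable borel" using w by auto
  have "(\<integral>s. (\<integral>y. w s * (mehler r x y * g s y) \<partial>lborel) \<partial>lborel) =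
        (\<integral>y. (\<integral>s. w s * (mehler r x y * g s y) \<partial>lborel) \<partial>lborel)"
  proof (rule Fubini_dominated[where a="\<lambda>s. \<bar>w s\<bar>" and k="\<lambda>s y. mehler r x y * M"])
    show "\<bar>w s * (mehler r x y * g s y)\<bar> \<le> \<bar>w s\<bar> * (mehler r x y * M)" for s y
      unfolding abs_mult using g[of s y] mehler_nonneg[of r x y]
      by (cases "w s = 0") (auto intro!: mult_left_mono)
    show "(\<integral>y. mehler r x y * M \<partial>lborel) \<le> (\<integral>y. mehler r x y * M \<partial>lborel)" ..
  qed (use w integrable_mehler[OF r, of x] in auto)
  moreover have "(\<integral>s. w s * (mehler r x y * g s y) \<partial>lborel) = mehler r x y * (\<integral>s. w s * g s y \<partial>lborel)" for y
    by (simp add: mult.left_commute[of "w _"])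
  ultimately show ?thesis
    by (simp add: ornstein_uhlenbeck_eq_mehler[OF r])
qed

lemma ornstein_uhlenbeck_cong_AE:
  assumes "r > 0" and [measurable]: "f \<in> borel_measurable borel" "g \<in> borel_measurable borel"
    and "AE y in lborel. f y = g y"
  shows "ornstein_uhlenbeck r f x = ornstein_uhlenbeck r g x"
  unfolding ornstein_uhlenbeck_eq_mehler[OF assms(1)]
  by (rule integral_cong_AE) (use assms(4) in \<open>auto elim!: eventually_mono\<close>)

text \<open>
Fubini's theorem reduces this to the Chapman-Kolmogorov equation. As \<open>f\<close> is bounded only almost
everywhere, it is first replaced by its truncation \<open>f'\<close>; the absolutely continuous kernel does not
see the difference.
\<close>
lemma ornstein_uhlenbeck_semigroup:
  fixes f :: "'a::euclidean_space \<Rightarrow> real"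
  assumes r: "r > 0" and q: "q > 0" and m [measurable]: "f \<in> borel_measurable borel"
    and f: "AE y in lborel. \<bar>f y\<bar> \<le> M"
  shows "ornstein_uhlenbeck r (ornstein_uhlenbeck q f) x = ornstein_uhlenbeck (r + q) f x"
proof -
  have M: "M \<ge> 0" using order_trans[OF abs_ge_zero ornstein_uhlenbeck_bound[OF r m f, of x]] by simp
  define f' where "f' = (\<lambda>y. if \<bar>f y\<bar> \<le> M then f y else 0)"
  have [measurable]: "f' \<in> borel_measurable borel" unfolding f'_def by measurable
  have f': "\<bar>f' y\<bar> \<le> M" for y using M by (simp add: f'_def)
  have "AE y in lborel. f y = f' y" using f by eventually_elim (simp add: f'_def)
  then have ou: "ornstein_uhlenbeck u f y = ornstein_uhlenbeck u f' y" if "u > 0" for u y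
    using that by (intro ornstein_uhlenbeck_cong_AE) auto
  have "(\<integral>z. (\<integral>y. mehler r x z * (mehler q z y * f' y) \<partial>lborel) \<partial>lborel) =
        (\<integral>y. (\<integral>z. mehler r x z * (mehler q z y * f' y) \<partial>lborel) \<partial>lborel)"
  proof (rule Fubini_dominated[where a="mehler r x" and k="\<lambda>z y. mehler q z y * M" and B=M])
    show "\<bar>mehler r x z * (mehler q z y * f' y)\<bar> \<le> mehler r x z * (mehler q z y * M)" for z y
      unfolding abs_mult using f'[of y] mehler_nonneg[of r x z] mehler_nonneg[of q z y]
      by (auto intro!: mult_left_mono)
  qed (simp_all add: integrable_mehler[OF r] integrable_mehler[OF q] integral_mehler[OF q] mehler_nonneg)
  also have "(\<integral>y. (\<integral>z. mehler r x z * (mehler q z y * f' y) \<partial>lborel) \<partial>lborel) =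
      (\<integral>y. mehler (r + q) x y * f' y \<partial>lborel)"
  proof -
    have "(\<integral>z. mehler r x z * (mehler q z y * f' y) \<partial>lborel) = (\<integral>z. mehler r x z * mehler q z y \<partial>lborel) * f' y" for y
      by (simp add: mult.assoc[symmetric])
    then show ?thesis
      by (simp only: has_bochner_integral_integral_eq[OF mehler_chapman_kolmogorov[OF r q]])
  qed
  finally have *: "(\<integral>z. (\<integral>y. mehler r x z * (mehler q z y * f' y) \<partial>lborel) \<partial>lborel) =
        (\<integral>y. mehler (r + q) x y * f' y \<partial>lborel)" .
  have "ornstein_uhlenbeck q f = ornstein_uhlenbeck q f'" using ou[OF q] by (rule ext)
  moreover have "ornstein_uhlenbeck (r + q) f x = ornstein_uhlenbeck (r + q) f' x"
      using r q by (intro ou) simp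
  ultimately show ?thesis
    using * r q by (simp add: ornstein_uhlenbeck_eq_mehler)
qed

section \<open>Time derivatives of the Poisson-Hermite semigroup\<close>

definition poisson_deriv :: "nat \<Rightarrow> real \<Rightarrow> ('a::euclidean_space \<Rightarrow> real) \<Rightarrow> 'a \<Rightarrow> real" where
  "poisson_deriv k t f x = (\<integral>r. levy k t r * ornstein_uhlenbeck r f x \<partial>lborel)"

lemma poisson_deriv_measurable [measurable (raw)]:
  assumes [measurable]: "f \<in> borel_measurable borel" "t \<in> borel_measurable M" "g \<in> borel_measurable M"
  shows "(\<lambda>x. poisson_deriv k (t x) f (g x)) \<in> borel_measurable M"
  unfolding poisson_deriv_def by measurable

lemma poisson_deriv_bound:
  assumes t: "t > 0" and [measurable]: "f \<in> borel_measurable borel"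
    and f: "AE y in lborel. \<bar>f y\<bar> \<le> M"
  shows "\<bar>poisson_deriv k t f x\<bar> \<le> (\<integral>r. \<bar>levy k t r\<bar> \<partial>lborel) * M"
  unfolding poisson_deriv_def
  by (rule levy_average_bound[OF t _ ornstein_uhlenbeck_bound[OF _ _ f]]) auto

lemma poisson_deriv_0_bound:
  assumes t: "t > 0" and m: "f \<in> borel_measurable borel"
    and f: "AE y in lborel. \<bar>f y\<bar> \<le> M"
  shows "\<bar>poisson_deriv 0 t f x\<bar> \<le> M"
  using poisson_deriv_bound[OF t m f, of 0 x] integral_levy_0[OF t] levy_0_nonneg[of t] t by simp

lemma poisson_hermite_eq:
  assumes t: "t > 0" and m [measurable]: "f \<in> borel_measurable borel"
    and f: "AE y in lborel. \<bar>f y\<bar> \<le> M"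
  shows "poisson_hermite t f x = poisson_deriv 0 t f x"
proof -
  have "integrable lborel (\<lambda>r. levy 0 t r * ornstein_uhlenbeck r f x)"
    by (rule integrable_levy_times[OF t _ ornstein_uhlenbeck_bound[OF _ m f]]) auto
  then show ?thesis
    using t levy_0_change_of_variables[OF t, of "\<lambda>r. ornstein_uhlenbeck r f x"]
    by (simp add: poisson_hermite_def poisson_deriv_def)
qed

lemma higher_deriv_poisson_hermite:
  assumes t: "t > 0" and m [measurable]: "f \<in> borel_measurable borel"
    and f: "AE y in lborel. \<bar>f y\<bar> \<le> M"
  shows "(deriv ^^ k) (\<lambda>s. poisson_hermite s f x) t = poisson_deriv k t f x"
proof -
  have "(deriv ^^ k) (\<lambda>s. poisson_hermite s f x) t =
      (\<integral>r. levy (0 + k) (0 + t) r * ornstein_uhlenbeck r f x \<partial>lborel)"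
    by (rule higher_deriv_levy_average[OF _ ornstein_uhlenbeck_bound[OF _ m f]])
       (use t poisson_hermite_eq[OF _ m f] in \<open>auto simp: poisson_deriv_def\<close>)
  then show ?thesis by (simp add: poisson_deriv_def)
qed

lemma ornstein_uhlenbeck_poisson_deriv:
  fixes f :: "'a::euclidean_space \<Rightarrow> real"
  assumes r: "r > 0" and a: "a > 0" and m [measurable]: "f \<in> borel_measurable borel"
    and f: "AE y in lborel. \<bar>f y\<bar> \<le> M"
  shows "ornstein_uhlenbeck r (poisson_deriv k a f) x =
         (\<integral>q. levy k a q * ornstein_uhlenbeck (r + q) f x \<partial>lborel)"
proof -
  have M: "M \<ge> 0" using order_trans[OF abs_ge_zero ornstein_uhlenbeck_bound[OF r m f, of x]] by simp
  have "ornstein_uhlenbeck r (poisson_deriv k a f) x =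
        (\<integral>q. levy k a q * ornstein_uhlenbeck r (ornstein_uhlenbeck q f) x \<partial>lborel)"
    unfolding poisson_deriv_def
  proof (rule ornstein_uhlenbeck_integral[OF r _ integrable_levy[OF a] _ M])
    show "\<bar>ornstein_uhlenbeck q f y\<bar> \<le> M" if "levy k a q \<noteq> 0" for q y
      using that by (cases "q > 0") (auto intro!: ornstein_uhlenbeck_bound[OF _ m f])
  qed measurable
  also have "\<dots> = (\<integral>q. levy k a q * ornstein_uhlenbeck (r + q) f x \<partial>lborel)"
  proof (rule Bochner_Integration.integral_cong[OF refl])
    fix q show "levy k a q * ornstein_uhlenbeck r (ornstein_uhlenbeck q f) x =
        levy k a q * ornstein_uhlenbeck (r + q) f x"
      by (cases "q > 0") (simp_all add: ornstein_uhlenbeck_semigroup[OF r _ m f])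
  qed
  finally show ?thesis .
qed

text \<open>
The function \<open>v \<mapsto> T\<^sub>v f(x)\<close> is bounded, and \<open>T\<^sub>r T\<^sub>q = T\<^sub>r\<^sub>+\<^sub>q\<close> turns the composition into the double
average of this function treated in \<open>levy_average_semigroup\<close>.
\<close>
lemma poisson_deriv_semigroup:
  fixes f :: "'a::euclidean_space \<Rightarrow> real"
  assumes s: "s > 0" and a: "a > 0" and m [measurable]: "f \<in> borel_measurable borel"
    and f: "AE y in lborel. \<bar>f y\<bar> \<le> M"
  shows "poisson_deriv j s (poisson_deriv k a f) x = poisson_deriv (j + k) (s + a) f x"
proof -
  have "poisson_deriv j s (poisson_deriv k a f) x =
      (\<integral>r. levy j s r * (\<integral>q. levy k a q * ornstein_uhlenbeck (r + q) f x \<partial>lborel) \<partial>lborel)"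
    unfolding poisson_deriv_def[of j s "poisson_deriv k a f"]
  proof (rule Bochner_Integration.integral_cong[OF refl])
    fix r show "levy j s r * ornstein_uhlenbeck r (poisson_deriv k a f) x =
        levy j s r * (\<integral>q. levy k a q * ornstein_uhlenbeck (r + q) f x \<partial>lborel)"
      by (cases "r > 0") (simp_all add: ornstein_uhlenbeck_poisson_deriv[OF _ a m f])
  qed
  also have "\<dots> = poisson_deriv (j + k) (s + a) f x"
    unfolding poisson_deriv_def
    by (rule levy_average_semigroup[OF s a _ ornstein_uhlenbeck_bound[OF _ m f]]) measurable
  finally show ?thesis .
qed

section \<open>The Bessel potential as an average of the Poisson-Hermite semigroup\<close>

text \<open>
The density of the Gamma distribution with shape \<open>\<beta>\<close>; the Bessel potential averages \<open>P\<^sub>s\<close> against it.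
\<close>
definition gamma_weight :: "real \<Rightarrow> real \<Rightarrow> real" where
  "gamma_weight \<beta> s = indicator {0<..} s * (s powr (\<beta> - 1) * exp (- s)) / Gamma \<beta>"

lemma gamma_weight_measurable [measurable]: "gamma_weight \<beta> \<in> borel_measurable borel"
  unfolding gamma_weight_def[abs_def] by measurable

lemma gamma_weight_nonneg: "\<beta> > 0 \<Longrightarrow> gamma_weight \<beta> s \<ge> 0"
  by (simp add: gamma_weight_def Gamma_real_pos less_imp_le)

lemma
  assumes b: "\<beta> > 0"
  shows integrable_gamma_weight: "integrable lborel (gamma_weight \<beta>)"
    and integral_gamma_weight: "(\<integral>s. gamma_weight \<beta> s \<partial>lborel) = 1"
proof -
  have "(\<integral>\<^sup>+s. ennreal (indicator {0..} s * s powr (\<beta> - 1) / exp s) \<partial>lborel) = ennreal (Gamma \<beta>)"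
    by (rule Gamma_conv_nn_integral_real[symmetric]) (fact b)
  moreover have "(\<integral>\<^sup>+s. ennreal (gamma_weight \<beta> s) \<partial>lborel) =
      (\<integral>\<^sup>+s. ennreal (1 / Gamma \<beta>) * ennreal (indicator {0..} s * s powr (\<beta> - 1) / exp s) \<partial>lborel)"
    using b by (intro nn_integral_cong)
      (auto simp: gamma_weight_def indicator_def exp_minus field_simps Gamma_real_pos less_imp_le simp flip: ennreal_mult)
  ultimately have n: "(\<integral>\<^sup>+s. ennreal (gamma_weight \<beta> s) \<partial>lborel) = ennreal 1"
    using Gamma_real_pos[OF b] by (subst (asm) nn_integral_cmult) (simp_all flip: ennreal_mult)
  have "has_bochner_integral lborel (gamma_weight \<beta>) 1"
    by (rule has_bochner_integral_nn_integral[OF _ _ _ n]) (auto simp: gamma_weight_nonneg[OF b])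
  then show "integrable lborel (gamma_weight \<beta>)" "(\<integral>s. gamma_weight \<beta> s \<partial>lborel) = 1"
    by (auto simp: has_bochner_integral_iff)
qed

lemma bessel_potential_eq:
  assumes m: "f \<in> borel_measurable borel" and f: "AE y in lborel. \<bar>f y\<bar> \<le> M"
  shows "bessel_potential \<beta> f x = (\<integral>s. gamma_weight \<beta> s * poisson_deriv 0 s f x \<partial>lborel)"
proof -
  have "bessel_potential \<beta> f x = (\<integral>s. 1 / Gamma \<beta> * (indicator {0<..} s *\<^sub>R (s powr (\<beta> - 1) * exp (- s) * poisson_hermite s f x)) \<partial>lborel)"
    unfolding bessel_potential_def set_lebesgue_integral_def by (rule integral_mult_right_zero[symmetric])
  also have "\<dots> = (\<integral>s. gamma_weight \<beta> s * poisson_deriv 0 s f x \<partial>lborel)"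
    by (intro Bochner_Integration.integral_cong refl)
       (auto simp: gamma_weight_def indicator_def poisson_hermite_eq[OF _ m f])
  finally show ?thesis .
qed

lemma bessel_potential_measurable:
  assumes m [measurable]: "f \<in> borel_measurable borel" and f: "AE y in lborel. \<bar>f y\<bar> \<le> M"
  shows "bessel_potential \<beta> f \<in> borel_measurable borel"
  unfolding bessel_potential_eq[OF m f, abs_def] by measurable

lemma gamma_weight_integral_bound:
  assumes b: "\<beta> > 0" and [measurable]: "h \<in> borel_measurable borel"
    and h: "\<And>s. s > 0 \<Longrightarrow> \<bar>h s\<bar> \<le> M"
  shows "\<bar>\<integral>s. gamma_weight \<beta> s * h s \<partial>lborel\<bar> \<le> M"
proof -
  have "\<bar>gamma_weight \<beta> s * h s\<bar> \<le> gamma_weight \<beta> s * M" for s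
    using mult_left_mono[OF h[of s] gamma_weight_nonneg[OF b, of s]] gamma_weight_nonneg[OF b, of s]
    unfolding abs_mult abs_of_nonneg[OF gamma_weight_nonneg[OF b, of s]]
    by (cases "s > 0") (simp_all add: gamma_weight_def)
  then have "norm (\<integral>s. gamma_weight \<beta> s * h s \<partial>lborel) \<le> (\<integral>s. gamma_weight \<beta> s * M \<partial>lborel)"
    using integrable_gamma_weight[OF b]
    by (intro Bochner_Integration.integral_norm_bound_integral)
       (auto intro!: Bochner_Integration.integrable_bound[where g="\<lambda>s. gamma_weight \<beta> s * h s" and f="\<lambda>s. gamma_weight \<beta> s * M"] AE_I2 order_trans[OF _ abs_ge_self] simp del: abs_mult)
  then show ?thesis using integral_gamma_weight[OF b] by simp
qed

lemma bessel_potential_bound: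
  assumes b: "\<beta> > 0" and m [measurable]: "f \<in> borel_measurable borel" and f: "AE y in lborel. \<bar>f y\<bar> \<le> M"
  shows "\<bar>bessel_potential \<beta> f x\<bar> \<le> M"
  unfolding bessel_potential_eq[OF m f]
  by (rule gamma_weight_integral_bound[OF b _ poisson_deriv_0_bound[OF _ m f]]) measurable

text \<open>
All the integrations involved can be exchanged, since \<open>P\<^sub>s f\<close> is bounded by \<open>M\<close> everywhere for
\<open>s > 0\<close>. What remains is \<open>D\<^sub>n\<^sub>,\<^sub>t P\<^sub>s = D\<^sub>n\<^sub>,\<^sub>t\<^sub>+\<^sub>s\<close>.
\<close>
lemma poisson_deriv_bessel_potential:
  fixes f :: "'a::euclidean_space \<Rightarrow> real"
  assumes b: "\<beta> > 0" and t: "t > 0" and m [measurable]: "f \<in> borel_measurable borel"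
    and f: "AE y in lborel. \<bar>f y\<bar> \<le> M"
  shows "poisson_deriv n t (bessel_potential \<beta> f) x =
         (\<integral>s. gamma_weight \<beta> s * poisson_deriv n (t + s) f x \<partial>lborel)"
proof -
  have M: "M \<ge> 0" using order_trans[OF abs_ge_zero ornstein_uhlenbeck_bound[OF t m f, of x]] by simp
  have ou: "ornstein_uhlenbeck r (bessel_potential \<beta> f) x =
      (\<integral>s. gamma_weight \<beta> s * ornstein_uhlenbeck r (poisson_deriv 0 s f) x \<partial>lborel)" if r: "r > 0" for r
    unfolding bessel_potential_eq[OF m f, abs_def]
  proof (rule ornstein_uhlenbeck_integral[OF r _ integrable_gamma_weight[OF b] _ M])
    show "\<bar>poisson_deriv 0 s f y\<bar> \<le> M" if "gamma_weight \<beta> s \<noteq> 0" for s y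
      using that by (cases "s > 0") (auto simp: gamma_weight_def intro!: poisson_deriv_0_bound[OF _ m f])
  qed measurable
  define I where "I = (\<lambda>r s. \<integral>q. levy 0 s q * ornstein_uhlenbeck (r + q) f x \<partial>lborel)"
  have I_m [measurable]: "(\<lambda>(r, s). I r s) \<in> borel_measurable (borel \<Otimes>\<^sub>M borel)"
    unfolding I_def by measurable
  have I: "ornstein_uhlenbeck r (poisson_deriv 0 s f) x = I r s" if "r > 0" "s > 0" for r s
    unfolding I_def by (rule ornstein_uhlenbeck_poisson_deriv[OF that m f])
  have I_bound: "\<bar>I r s\<bar> \<le> M" if "r > 0" "s > 0" for r s
    unfolding I[OF that, symmetric]
    by (rule ornstein_uhlenbeck_bound) (use that poisson_deriv_0_bound[OF _ m f] in auto)
  have "poisson_deriv n t (bessel_potential \<beta> f) x =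
      (\<integral>r. (\<integral>s. levy n t r * (gamma_weight \<beta> s * I r s) \<partial>lborel) \<partial>lborel)"
    unfolding poisson_deriv_def[of n t "bessel_potential \<beta> f"]
  proof (rule Bochner_Integration.integral_cong[OF refl])
    fix r
    have "gamma_weight \<beta> s * ornstein_uhlenbeck r (poisson_deriv 0 s f) x = gamma_weight \<beta> s * I r s" if "r > 0" for s
      using I[OF that, of s] by (cases "s > 0") (auto simp: gamma_weight_def)
    then have "ornstein_uhlenbeck r (bessel_potential \<beta> f) x = (\<integral>s. gamma_weight \<beta> s * I r s \<partial>lborel)" if "r > 0"
      using that by (simp only: ou)
    then show "levy n t r * ornstein_uhlenbeck r (bessel_potential \<beta> f) x =
        (\<integral>s. levy n t r * (gamma_weight \<beta> s * I r s) \<partial>lborel)"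
      by (cases "r > 0") simp_all
  qed
  also have "\<dots> = (\<integral>s. (\<integral>r. levy n t r * (gamma_weight \<beta> s * I r s) \<partial>lborel) \<partial>lborel)"
  proof (rule Fubini_dominated[where a="\<lambda>r. \<bar>levy n t r\<bar>" and k="\<lambda>r s. gamma_weight \<beta> s * M" and B=M])
    show "\<bar>levy n t r * (gamma_weight \<beta> s * I r s)\<bar> \<le> \<bar>levy n t r\<bar> * (gamma_weight \<beta> s * M)" for r s
    proof (cases "r > 0 \<and> s > 0")
      case True
      then show ?thesis unfolding abs_mult using I_bound[of r s] gamma_weight_nonneg[OF b, of s]
        by (auto intro!: mult_left_mono)
    qed (auto simp: gamma_weight_def)
  qed (use integrable_levy[OF t] integrable_gamma_weight[OF b] integral_gamma_weight[OF b] in auto)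
  also have "\<dots> = (\<integral>s. gamma_weight \<beta> s * poisson_deriv n (t + s) f x \<partial>lborel)"
  proof (rule Bochner_Integration.integral_cong[OF refl])
    fix s
    have "(\<integral>r. levy n t r * I r s \<partial>lborel) = poisson_deriv n (t + s) f x" if s: "s > 0"
    proof -
      have "(\<integral>r. levy n t r * I r s \<partial>lborel) = poisson_deriv (n + 0) (t + s) f x"
        unfolding I_def poisson_deriv_def
        by (rule levy_average_semigroup[OF t s _ ornstein_uhlenbeck_bound[OF _ m f]]) measurable
      then show ?thesis by simp
    qed
    moreover have "(\<integral>r. levy n t r * (gamma_weight \<beta> s * I r s) \<partial>lborel) =
        gamma_weight \<beta> s * (\<integral>r. levy n t r * I r s \<partial>lborel)"
      by (simp add: mult.left_commute)
    ultimately show "(\<integral>r. levy n t r * (gamma_weight \<beta> s * I r s) \<partial>lborel) =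
        gamma_weight \<beta> s * poisson_deriv n (t + s) f x"
      by (cases "s > 0") (auto simp: gamma_weight_def)
  qed
  finally show ?thesis .
qed

text \<open>
Drop \<open>e\<^bsup>-s\<^esup>\<close> and bound \<open>(t + s)\<^bsup>-\<kappa>\<^esup>\<close> by \<open>t\<^bsup>-\<kappa>\<^esup>\<close> for \<open>s \<le> t\<close> and by \<open>s\<^bsup>-\<kappa>\<^esup>\<close> for
\<open>s > t\<close>. The first piece is integrable because \<open>\<beta> > 0\<close>, the second because \<open>\<kappa> > \<beta>\<close>.
\<close>
lemma gamma_weight_power_integral:
  assumes b: "\<beta> > 0" and k: "\<kappa> > \<beta>" and t: "t > 0"
  shows "integrable lborel (\<lambda>s. gamma_weight \<beta> s * (t + s) powr (- \<kappa>))"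
    and "(\<integral>s. gamma_weight \<beta> s * (t + s) powr (- \<kappa>) \<partial>lborel) \<le>
           (1 / \<beta> + 1 / (\<kappa> - \<beta>)) / Gamma \<beta> * t powr (\<beta> - \<kappa>)"
proof -
  let ?W = "\<lambda>s. indicator {0..t} s * s powr (\<beta> - 1) * t powr (- \<kappa>) + indicator {t..} s * s powr (\<beta> - 1 - \<kappa>)"
  have 1: "has_bochner_integral lborel (\<lambda>s. indicator {0..t} s * s powr (\<beta> - 1)) (t powr \<beta> / \<beta>)"
  proof -
    have "((\<lambda>s. s powr (\<beta> - 1)) has_integral (t powr (\<beta> - 1 + 1) / (\<beta> - 1 + 1))) {0..t}"
      by (rule has_integral_powr_from_0) (use b t in auto)
    then have "(\<integral>\<^sup>+s. ennreal (indicator {0..t} s * s powr (\<beta> - 1)) \<partial>lborel) = ennreal (t powr \<beta> / \<beta>)"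
      by (intro nn_integral_has_integral_lebesgue) auto
    then show ?thesis
      by (intro has_bochner_integral_nn_integral) (use b in \<open>auto simp: mult.commute\<close>)
  qed
  have 2: "has_bochner_integral lborel (\<lambda>s. indicator {t..} s * s powr (\<beta> - 1 - \<kappa>)) (t powr (\<beta> - \<kappa>) / (\<kappa> - \<beta>))"
  proof -
    have "((\<lambda>s. s powr (\<beta> - 1 - \<kappa>)) has_integral - (t powr (\<beta> - 1 - \<kappa> + 1)) / (\<beta> - 1 - \<kappa> + 1)) {t..}"
      by (rule has_integral_powr_to_inf) (use k t in auto)
    also have "- (t powr (\<beta> - 1 - \<kappa> + 1)) / (\<beta> - 1 - \<kappa> + 1) = t powr (\<beta> - \<kappa>) / (\<kappa> - \<beta>)"
      using k by (simp add: divide_simps) (simp add: algebra_simps)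
    finally have "(\<integral>\<^sup>+s. ennreal (indicator {t..} s * s powr (\<beta> - 1 - \<kappa>)) \<partial>lborel) = ennreal (t powr (\<beta> - \<kappa>) / (\<kappa> - \<beta>))"
      by (intro nn_integral_has_integral_lebesgue) auto
    then show ?thesis
      by (intro has_bochner_integral_nn_integral) (use k in auto)
  qed
  have sum: "t powr \<beta> / \<beta> * t powr (- \<kappa>) + t powr (\<beta> - \<kappa>) / (\<kappa> - \<beta>) =
      (1 / \<beta> + 1 / (\<kappa> - \<beta>)) * t powr (\<beta> - \<kappa>)"
    by (simp add: powr_diff powr_minus divide_inverse algebra_simps)
  have W: "has_bochner_integral lborel ?W ((1 / \<beta> + 1 / (\<kappa> - \<beta>)) * t powr (\<beta> - \<kappa>))"
    unfolding sum[symmetric]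
    by (intro has_bochner_integral_add has_bochner_integral_mult_left 1 2)
  have G: "Gamma \<beta> > 0" using b by (rule Gamma_real_pos)
  have le: "gamma_weight \<beta> s * (t + s) powr (- \<kappa>) \<le> 1 / Gamma \<beta> * ?W s" for s
  proof (cases "s > 0")
    case s: True
    have "gamma_weight \<beta> s * (t + s) powr (- \<kappa>) = 1 / Gamma \<beta> * (exp (- s) * (s powr (\<beta> - 1) * (t + s) powr (- \<kappa>)))"
      using s by (simp add: gamma_weight_def)
    also have "\<dots> \<le> 1 / Gamma \<beta> * (1 * (s powr (\<beta> - 1) * (t + s) powr (- \<kappa>)))"
      using s G by (intro mult_left_mono mult_right_mono) auto
    also have "\<dots> \<le> 1 / Gamma \<beta> * ?W s"
    proof (intro mult_left_mono)
      show "1 * (s powr (\<beta> - 1) * (t + s) powr (- \<kappa>)) \<le> ?W s"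
      proof (cases "s \<le> t")
        case True
        have "(t + s) powr (- \<kappa>) \<le> t powr (- \<kappa>)"
          using s t k b by (intro powr_mono2') auto
        then have "s powr (\<beta> - 1) * (t + s) powr (- \<kappa>) \<le> s powr (\<beta> - 1) * t powr (- \<kappa>)"
          by (rule mult_left_mono) simp
        moreover have "s powr (\<beta> - 1) * t powr (- \<kappa>) \<le> ?W s"
          using True s by (simp add: indicator_def)
        ultimately show ?thesis by simp
      next
        case False
        have "(t + s) powr (- \<kappa>) \<le> s powr (- \<kappa>)"
          using s t k b by (intro powr_mono2') auto
        then have "s powr (\<beta> - 1) * (t + s) powr (- \<kappa>) \<le> s powr (\<beta> - 1) * s powr (- \<kappa>)"
          by (rule mult_left_mono) simp
        also have "\<dots> = s powr (\<beta> - 1 - \<kappa>)" by (simp only: powr_add[symmetric]) simp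
        finally show ?thesis using False by (simp add: indicator_def)
      qed
    qed (use G in auto)
    finally show ?thesis .
  qed (use G in \<open>auto simp: gamma_weight_def\<close>)
  have Wi: "integrable lborel (\<lambda>s. 1 / Gamma \<beta> * ?W s)"
    by (rule integrable_mult_right) (rule integrable.intros[OF W])
  show I: "integrable lborel (\<lambda>s. gamma_weight \<beta> s * (t + s) powr (- \<kappa>))"
  proof (rule Bochner_Integration.integrable_bound[OF Wi])
    show "AE s in lborel. norm (gamma_weight \<beta> s * (t + s) powr (- \<kappa>)) \<le> norm (1 / Gamma \<beta> * ?W s)"
    proof (rule AE_I2)
      fix s
      have "norm (gamma_weight \<beta> s * (t + s) powr (- \<kappa>)) = gamma_weight \<beta> s * (t + s) powr (- \<kappa>)"
        using gamma_weight_nonneg[OF b, of s] by (simp add: abs_mult)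
      then show "norm (gamma_weight \<beta> s * (t + s) powr (- \<kappa>)) \<le> norm (1 / Gamma \<beta> * ?W s)"
        using le[of s] unfolding real_norm_def by linarith
    qed
  qed measurable
  have "(\<integral>s. gamma_weight \<beta> s * (t + s) powr (- \<kappa>) \<partial>lborel) \<le> (\<integral>s. 1 / Gamma \<beta> * ?W s \<partial>lborel)"
    by (rule integral_mono[OF I Wi le])
  also have "\<dots> = 1 / Gamma \<beta> * ((1 / \<beta> + 1 / (\<kappa> - \<beta>)) * t powr (\<beta> - \<kappa>))"
    using has_bochner_integral_integral_eq[OF W] by (simp only: integral_mult_right_zero)
  finally show "(\<integral>s. gamma_weight \<beta> s * (t + s) powr (- \<kappa>) \<partial>lborel) \<le>
      (1 / \<beta> + 1 / (\<kappa> - \<beta>)) / Gamma \<beta> * t powr (\<beta> - \<kappa>)" by simp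
qed

section \<open>Essential suprema and Lipschitz constants\<close>

lemma AE_gauss_iff: "(AE x in (gauss :: 'a::euclidean_space measure). P x) \<longleftrightarrow> (AE x in lborel. P x)"
  unfolding gauss_def by (subst AE_density) auto

lemma borel_measurable_gauss_iff: "f \<in> borel_measurable (gauss :: 'a::euclidean_space measure) \<longleftrightarrow> f \<in> borel_measurable borel"
  unfolding gauss_def by (simp add: measurable_def)

lemma emeasure_gauss_space: "emeasure (gauss :: 'a::euclidean_space measure) (space gauss) \<noteq> 0"
proof
  assume "emeasure (gauss :: 'a measure) (space gauss) = 0"
  then have "AE x in (gauss :: 'a measure). False"
    by (intro AE_I[where N="space gauss"]) auto
  then have "AE x in (lborel :: 'a measure). False" unfolding AE_gauss_iff .
  then have "emeasure (lborel :: 'a measure) UNIV = 0"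
    by (simp add: AE_iff_measurable[where N=UNIV])
  then show False by simp
qed

lemma Linf_norm_le:
  assumes "f \<in> borel_measurable borel" "AE x in lborel. \<bar>f x\<bar> \<le> c"
  shows "Linf_norm f \<le> ereal c"
  unfolding Linf_norm_def
  using assms by (intro esssup_I) (auto simp: borel_measurable_gauss_iff AE_gauss_iff)

lemma Linf_norm_leD:
  assumes "Linf_norm f \<le> ereal c"
  shows "AE x in lborel. \<bar>f x\<bar> \<le> c"
proof -
  have "AE x in gauss. ereal \<bar>f x\<bar> \<le> Linf_norm f"
    unfolding Linf_norm_def by (rule esssup_AE)
  then show ?thesis unfolding AE_gauss_iff
    by eventually_elim (use assms order_trans in fastforce)
qed

lemma Linf_norm_nonneg: "Linf_norm f \<ge> 0"
proof (cases "(\<lambda>x. ereal \<bar>f x\<bar>) \<in> borel_measurable gauss")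
  case True
  have "esssup (gauss :: 'a measure) (\<lambda>_. 0 :: ereal) \<le> Linf_norm f"
    unfolding Linf_norm_def by (rule esssup_mono) auto
  then show ?thesis by (simp add: esssup_const[OF emeasure_gauss_space])
qed (simp add: Linf_norm_def esssup_non_measurable)

lemma Linf_obtain:
  assumes "f \<in> Linf"
  obtains M where "M \<ge> 0" "Linf_norm f = ereal M" "f \<in> borel_measurable borel" "AE x in lborel. \<bar>f x\<bar> \<le> M"
proof -
  have "Linf_norm f < \<infinity>" "f \<in> borel_measurable borel"
    using assms by (auto simp: Linf_def borel_measurable_gauss_iff)
  moreover obtain M where "Linf_norm f = ereal M"
    using \<open>Linf_norm f < \<infinity>\<close> Linf_norm_nonneg[of f] by (cases "Linf_norm f") auto
  ultimately show ?thesis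
    using that[of M] Linf_norm_nonneg[of f] Linf_norm_leD[of f M] by simp
qed

lemma lip_bound_iff:
  assumes m: "f \<in> borel_measurable borel" and f: "AE x in lborel. \<bar>f x\<bar> \<le> M"
  shows "lip_bound \<alpha> f A \<longleftrightarrow>
    (\<forall>t>0. AE x in lborel. \<bar>poisson_deriv (lip_order \<alpha>) t f x\<bar> \<le> A * t powr (- real (lip_order \<alpha>) + \<alpha>))"
proof -
  have [measurable]: "f \<in> borel_measurable borel" by (rule m)
  have "Linf_norm (poisson_deriv n t f) \<le> ereal c \<longleftrightarrow> (AE x in lborel. \<bar>poisson_deriv n t f x\<bar> \<le> c)" for n t c
    by (auto intro: Linf_norm_le Linf_norm_leD)
  then show ?thesis
    unfolding lip_bound_def by (simp add: higher_deriv_poisson_hermite[OF _ m f])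
qed

lemma lip_bound_nonneg:
  assumes "lip_bound \<alpha> f A"
  shows "A \<ge> 0"
proof -
  have "Linf_norm (\<lambda>x. (deriv ^^ lip_order \<alpha>) (\<lambda>s. poisson_hermite s f x) 1) \<le> ereal A"
    using assms unfolding lip_bound_def by (elim allE[of _ 1]) simp
  then show ?thesis using order_trans[OF Linf_norm_nonneg] by fastforce
qed

text \<open>
The nonempty set of admissible constants is bounded below by 0 and contains its infimum, so the
least constant in the definition of \<open>lip_const\<close> exists.
\<close>
lemma lip_const:
  assumes "lip_bound \<alpha> f A"
  shows lip_bound_lip_const: "lip_bound \<alpha> f (lip_const \<alpha> f)"
    and lip_const_le: "lip_const \<alpha> f \<le> A"
proof -
  define S where "S = {A. lip_bound \<alpha> f A}"
  have S: "A \<in> S" "bdd_below S" using assms lip_bound_nonneg by (auto simp: S_def intro!: bdd_belowI[of _ 0])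
  have "lip_bound \<alpha> f (Inf S)"
    unfolding lip_bound_def
  proof (intro allI impI)
    fix t :: real assume t: "t > 0"
    let ?p = "t powr (- real (lip_order \<alpha>) + \<alpha>)"
    let ?N = "Linf_norm (\<lambda>x. (deriv ^^ lip_order \<alpha>) (\<lambda>s. poisson_hermite s f x) t)"
    have p: "?p > 0" using t by simp
    have N: "?N \<le> ereal (B * ?p)" if "B \<in> S" for B using that t by (auto simp: S_def lip_bound_def)
    obtain c where c: "?N = ereal c" using N[OF S(1)] Linf_norm_nonneg[of "\<lambda>x. (deriv ^^ lip_order \<alpha>) (\<lambda>s. poisson_hermite s f x) t"]
      by (cases ?N) auto
    have "c / ?p \<le> Inf S"
      using S(1) N p by (intro cInf_greatest) (auto simp: c field_simps)
    then show "?N \<le> ereal (Inf S * ?p)" using p by (simp add: c field_simps)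
  qed
  moreover have "Inf S \<le> B" if "lip_bound \<alpha> f B" for B
    using that S(2) by (intro cInf_lower) (auto simp: S_def)
  ultimately have "lip_const \<alpha> f = Inf S" unfolding lip_const_def by (intro Least_equality)
  then show "lip_bound \<alpha> f (lip_const \<alpha> f)" "lip_const \<alpha> f \<le> A"
    using \<open>lip_bound \<alpha> f (Inf S)\<close> cInf_lower[OF S] by auto
qed

lemma lip_order: "\<alpha> < real (lip_order \<alpha>)"
  unfolding lip_order_def by (rule LeastI_ex) (rule reals_Archimedean2)

lemma lip_order_mono: "\<alpha> \<le> \<alpha>' \<Longrightarrow> lip_order \<alpha> \<le> lip_order \<alpha>'"
  unfolding lip_order_def[of \<alpha>] using lip_order[of \<alpha>'] by (intro Least_le) linarith

section \<open>Boundedness of the Bessel potential\<close>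

text \<open>
Split \<open>D\<^sub>n\<^sub>,\<^sub>t = D\<^sub>n\<^sub>-\<^sub>m\<^sub>,\<^sub>t\<^sub>/\<^sub>2 D\<^sub>m\<^sub>,\<^sub>t\<^sub>/\<^sub>2\<close>. The operator \<open>D\<^sub>n\<^sub>-\<^sub>m\<^sub>,\<^sub>t\<^sub>/\<^sub>2\<close> costs a factor \<open>t\<^bsup>-(n-m)\<^esup>\<close>
and, having an absolutely continuous kernel, upgrades a bound almost everywhere to a bound at every
point.
\<close>
lemma poisson_deriv_lip_bound:
  assumes "m \<le> n"
  shows "\<exists>C\<ge>0. \<forall>f :: 'a::euclidean_space \<Rightarrow> real. \<forall>M A. f \<in> borel_measurable borel \<longrightarrow> (AE x in lborel. \<bar>f x\<bar> \<le> M) \<longrightarrow>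
     A \<ge> 0 \<longrightarrow> (\<forall>t>0. AE x in lborel. \<bar>poisson_deriv m t f x\<bar> \<le> A * t powr (- real m + \<alpha>)) \<longrightarrow>
     (\<forall>t>0. \<forall>x. \<bar>poisson_deriv n t f x\<bar> \<le> C * A * t powr (- real n + \<alpha>))"
proof -
  obtain C where C: "C \<ge> 0" "\<And>t. t > 0 \<Longrightarrow> (\<integral>r. \<bar>levy (n - m) t r\<bar> \<partial>lborel) \<le> C / t ^ (n - m)"
    using integral_abs_levy_le[of "n - m"] by metis
  show ?thesis
  proof (intro exI[of _ "C * (1 / 2) powr (- real n + \<alpha>)"] conjI allI impI)
    fix f :: "'a \<Rightarrow> real" and M A t :: real and x :: 'a
    assume m [measurable]: "f \<in> borel_measurable borel" and f: "AE x in lborel. \<bar>f x\<bar> \<le> M" and A: "A \<ge> 0"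
      and lip: "\<forall>t>0. AE x in lborel. \<bar>poisson_deriv m t f x\<bar> \<le> A * t powr (- real m + \<alpha>)" and t: "t > 0"
    define u where "u = t / 2"
    have u: "u > 0" and tu: "t = u + u" using t by (auto simp: u_def)
    have "poisson_deriv n t f x = poisson_deriv (n - m) u (poisson_deriv m u f) x"
      using poisson_deriv_semigroup[OF u u m f, of "n - m" m x] assms by (simp add: tu)
    also have "\<bar>\<dots>\<bar> \<le> (\<integral>r. \<bar>levy (n - m) u r\<bar> \<partial>lborel) * (A * u powr (- real m + \<alpha>))"
      by (rule poisson_deriv_bound[OF u]) (use lip u in auto)
    also have "\<dots> \<le> C / u ^ (n - m) * (A * u powr (- real m + \<alpha>))"
      by (rule mult_right_mono[OF C(2)[OF u]]) (use A in auto)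
    also have "\<dots> = C * A * (u powr (- real (n - m)) * u powr (- real m + \<alpha>))"
      using u by (simp add: powr_minus powr_realpow divide_inverse)
    also have "u powr (- real (n - m)) * u powr (- real m + \<alpha>) = u powr (- real n + \<alpha>)"
      using assms by (simp add: of_nat_diff flip: powr_add)
    also have "u powr (- real n + \<alpha>) = (1 / 2) powr (- real n + \<alpha>) * t powr (- real n + \<alpha>)"
      using t powr_mult[of "1/2" t] by (simp add: u_def)
    finally show "\<bar>poisson_deriv n t f x\<bar> \<le> C * (1 / 2) powr (- real n + \<alpha>) * A * t powr (- real n + \<alpha>)"
      by (simp add: mult_ac)
  qed (use C in auto)
qed

text \<open>
The pointwise bound \<open>\<bar>D\<^sub>n\<^sub>,\<^sub>t\<^sub>+\<^sub>s f(x)\<bar> \<le> C A (t + s)\<^bsup>-n+\<alpha>\<^esup>\<close> is integrated against the Gamma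
density in \<open>s\<close>; the integral gains the factor \<open>t\<^bsup>\<beta>\<^esup>\<close>.
\<close>
lemma bessel_potential_lip_bound:
  assumes b: "\<beta> > 0"
  shows "\<exists>C\<ge>0. \<forall>(f :: 'a::euclidean_space \<Rightarrow> real) A. f \<in> Linf \<longrightarrow> lip_bound \<alpha> f A \<longrightarrow>
     lip_bound (\<alpha> + \<beta>) (bessel_potential \<beta> f) (C * A)"
proof -
  define m where "m = lip_order \<alpha>"
  define n where "n = lip_order (\<alpha> + \<beta>)"
  have mn: "m \<le> n" unfolding m_def n_def using b by (intro lip_order_mono) simp
  have n: "real n - \<alpha> > \<beta>" using lip_order[of "\<alpha> + \<beta>"] by (simp add: n_def)
  obtain C where C: "C \<ge> 0" and lipC: "\<And>(f :: 'a \<Rightarrow> real) M A t x. f \<in> borel_measurable borel \<Longrightarrow> (AE x in lborel. \<bar>f x\<bar> \<le> M) \<Longrightarrow>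
     A \<ge> 0 \<Longrightarrow> (\<forall>t>0. AE x in lborel. \<bar>poisson_deriv m t f x\<bar> \<le> A * t powr (- real m + \<alpha>)) \<Longrightarrow> t > 0 \<Longrightarrow>
     \<bar>poisson_deriv n t f x\<bar> \<le> C * A * t powr (- real n + \<alpha>)"
    using poisson_deriv_lip_bound[OF mn, of \<alpha>, where 'a='a] by metis
  define D where "D = (1 / \<beta> + 1 / ((real n - \<alpha>) - \<beta>)) / Gamma \<beta>"
  have D: "D \<ge> 0" using b n Gamma_real_pos[OF b] by (simp add: D_def)
  show ?thesis
  proof (intro exI[of _ "C * D"] conjI allI impI)
    fix f :: "'a \<Rightarrow> real" and A
    assume f: "f \<in> Linf" and lip: "lip_bound \<alpha> f A"
    from f obtain M where fm [measurable]: "f \<in> borel_measurable borel" and fM: "AE x in lborel. \<bar>f x\<bar> \<le> M"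
      by (rule Linf_obtain)
    have A: "A \<ge> 0" using lip by (rule lip_bound_nonneg)
    have pd: "\<bar>poisson_deriv n t f x\<bar> \<le> C * A * t powr (- real n + \<alpha>)" if "t > 0" for t x
      using lipC[OF fm fM A _ that] lip unfolding lip_bound_iff[OF fm fM] m_def by blast
    have Jm: "bessel_potential \<beta> f \<in> borel_measurable borel"
      by (rule bessel_potential_measurable[OF fm fM])
    have JM: "AE x in lborel. \<bar>bessel_potential \<beta> f x\<bar> \<le> M"
      using bessel_potential_bound[OF b fm fM] by auto
    have "\<bar>poisson_deriv n t (bessel_potential \<beta> f) x\<bar> \<le> C * D * A * t powr (- real n + (\<alpha> + \<beta>))" if t: "t > 0" for t x
    proof -
      note gw = gamma_weight_power_integral[OF b n t]
      have le: "norm (gamma_weight \<beta> s * poisson_deriv n (t + s) f x) \<le> C * A * (gamma_weight \<beta> s * (t + s) powr (- (real n - \<alpha>)))" for s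
      proof (cases "s > 0")
        case True
        then show ?thesis
          using mult_left_mono[OF pd[of "t + s" x] gamma_weight_nonneg[OF b, of s]] t gamma_weight_nonneg[OF b, of s]
          by (simp add: abs_mult mult_ac)
      qed (simp add: gamma_weight_def)
      have "norm (\<integral>s. gamma_weight \<beta> s * poisson_deriv n (t + s) f x \<partial>lborel) \<le>
          (\<integral>s. C * A * (gamma_weight \<beta> s * (t + s) powr (- (real n - \<alpha>))) \<partial>lborel)"
      proof (rule Bochner_Integration.integral_norm_bound_integral)
        show I: "integrable lborel (\<lambda>s. C * A * (gamma_weight \<beta> s * (t + s) powr (- (real n - \<alpha>))))"
          by (rule integrable_mult_right) (rule gw(1))
        show "integrable lborel (\<lambda>s. gamma_weight \<beta> s * poisson_deriv n (t + s) f x)"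
          by (rule Bochner_Integration.integrable_bound[OF I])
             (use order_trans[OF le abs_ge_self] in \<open>auto intro!: AE_I2 simp del: abs_mult\<close>)
      qed (rule le)
      also have "\<dots> = C * A * (\<integral>s. gamma_weight \<beta> s * (t + s) powr (- (real n - \<alpha>)) \<partial>lborel)"
        by simp
      also have "\<dots> \<le> C * A * (D * t powr (\<beta> - (real n - \<alpha>)))"
        unfolding D_def by (rule mult_left_mono[OF gw(2)]) (use C A in auto)
      finally show ?thesis
        unfolding poisson_deriv_bessel_potential[OF b t fm fM] by (simp add: algebra_simps)
    qed
    then show "lip_bound (\<alpha> + \<beta>) (bessel_potential \<beta> f) (C * D * A)"
      unfolding lip_bound_iff[OF Jm JM] n_def by auto
  qed (use C D in auto)
qed

theorem theorem3p1:
  fixes \<alpha> \<beta> :: real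
  assumes "\<alpha> > 0" and "\<beta> > 0"
  shows "(\<forall>f :: real ^ 'd \<Rightarrow> real. f \<in> gauss_Lip \<alpha> \<longrightarrow>
            bessel_potential \<beta> f \<in> gauss_Lip (\<alpha> + \<beta>)) \<and>
         (\<exists>C::real. \<forall>f :: real ^ 'd \<Rightarrow> real. f \<in> gauss_Lip \<alpha> \<longrightarrow>
            gauss_Lip_norm (\<alpha> + \<beta>) (bessel_potential \<beta> f)
              \<le> ereal C * gauss_Lip_norm \<alpha> f)"
proof -
  obtain C where C: "C \<ge> 0" and lip: "\<And>(f :: real ^ 'd \<Rightarrow> real) A. f \<in> Linf \<Longrightarrow> lip_bound \<alpha> f A \<Longrightarrow>
     lip_bound (\<alpha> + \<beta>) (bessel_potential \<beta> f) (C * A)"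
    using bessel_potential_lip_bound[OF assms(2), where 'a="real ^ 'd"] by metis
  have J: "bessel_potential \<beta> f \<in> gauss_Lip (\<alpha> + \<beta>) \<and>
      gauss_Lip_norm (\<alpha> + \<beta>) (bessel_potential \<beta> f) \<le> ereal (max 1 C) * gauss_Lip_norm \<alpha> f"
    if "f \<in> gauss_Lip \<alpha>" for f :: "real ^ 'd \<Rightarrow> real"
  proof -
    from that obtain A where f: "f \<in> Linf" and "lip_bound \<alpha> f A" by (auto simp: gauss_Lip_def)
    then have lf: "lip_bound \<alpha> f (lip_const \<alpha> f)" by (intro lip_bound_lip_const)
    from f obtain M where M: "M \<ge> 0" "Linf_norm f = ereal M" and fm: "f \<in> borel_measurable borel"
      and fM: "AE x in lborel. \<bar>f x\<bar> \<le> M"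
      by (rule Linf_obtain)
    have Jm: "bessel_potential \<beta> f \<in> borel_measurable borel"
      by (rule bessel_potential_measurable[OF fm fM])
    have JM: "Linf_norm (bessel_potential \<beta> f) \<le> ereal M"
      by (rule Linf_norm_le[OF Jm]) (simp add: bessel_potential_bound[OF assms(2) fm fM])
    have lJ: "lip_bound (\<alpha> + \<beta>) (bessel_potential \<beta> f) (C * lip_const \<alpha> f)"
      by (rule lip[OF f lf])
    have "bessel_potential \<beta> f \<in> Linf"
      using JM Jm by (auto simp: Linf_def borel_measurable_gauss_iff)
    with lJ have in_lip: "bessel_potential \<beta> f \<in> gauss_Lip (\<alpha> + \<beta>)" by (auto simp: gauss_Lip_def)
    have "gauss_Lip_norm (\<alpha> + \<beta>) (bessel_potential \<beta> f) \<le> ereal M + ereal (C * lip_const \<alpha> f)"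
      unfolding gauss_Lip_norm_def by (intro add_mono JM) (simp add: lip_const_le[OF lJ])
    also have "\<dots> \<le> ereal (max 1 C * (M + lip_const \<alpha> f))"
      using mult_right_mono[of 1 "max 1 C" M] mult_right_mono[of C "max 1 C" "lip_const \<alpha> f"] M(1) lip_bound_nonneg[OF lf]
      by (simp add: distrib_left)
    also have "\<dots> = ereal (max 1 C) * gauss_Lip_norm \<alpha> f"
      unfolding gauss_Lip_norm_def M(2) by (simp only: plus_ereal.simps times_ereal.simps)
    finally show ?thesis using in_lip by blast
  qed
  then show ?thesis by blast
qed

end
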